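(* Let $d\ge 2$ and $1\le j,k\le d-1$. Let $\mu$ be the measure on $\mathbb{R}^d$ which is the sum of the $k$-dimensional Lebesgue (area) measure on $[0,1]^k\times\{0\}^{d-k}$ and the $j$-dimensional Lebesgue (area) measure on $\{0\}^{d-j}\times[0,1]^j$. Then $L^2(\mu)$ admits a Fourier frame.
   Context: For $\lambda\in\mathbb{R}^d$ let $e_\lambda(x)=e^{2\pi i\langle\lambda,x\rangle}$. For a positive finite Borel measure $\mu$ on $\mathbb{R}^d$ and a countable set $\Lambda\subset\mathbb{R}^d$, the system $E(\Lambda)=\{e_\lambda\}_{\lambda\in\Lambda}$ is a Fourier frame for $L^2(\mu)$ if there are constants $0<A,B<\infty$ with $A\|f\|^2_{L^2(\mu)}\le\sum_{\lambda\in\Lambda}|\langle f,e_\lambda\rangle_{L^2(\mu)}|^2\le B\|f\|^2_{L^2(\mu)}$ for all $f\in L^2(\mu)$. "$L^2(\mu)$ admits a Fourier frame" means such a $\Lambda$ exists. *)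

theory Defs
  imports "HOL-Analysis.Analysis"
begin

text \<open>Points of R^d are represented as extensional functions on the index set {..<d}
  (coordinates 0..d-1), i.e. elements of the space of the product measure below.\<close>

definition euclid :: "nat \<Rightarrow> (nat \<Rightarrow> real) measure" where
  "euclid d = PiM {..<d} (\<lambda>_. lborel)"

definition add_measure :: "'a measure \<Rightarrow> 'a measure \<Rightarrow> 'a measure" where
  "add_measure M N = measure_of (space M) (sets M) (\<lambda>A. emeasure M A + emeasure N A)"

text \<open>The k-dimensional Lebesgue measure on the unit cube sitting in the coordinates
  off, ..., off+k-1 of R^d (all other coordinates zero): push-forward of Lebesgue measure
  on [0,1]^k under the corresponding isometric embedding.\<close>
definition cube_measure :: "nat \<Rightarrow> nat \<Rightarrow> nat \<Rightarrow> (nat \<Rightarrow> real) measure" where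
  "cube_measure d k off =
     distr (PiM {..<k} (\<lambda>_. restrict_space lborel {0..1})) (euclid d)
       (\<lambda>x. restrict (\<lambda>i. if off \<le> i \<and> i < off + k then x (i - off) else 0) {..<d})"

definition inner_d :: "nat \<Rightarrow> (nat \<Rightarrow> real) \<Rightarrow> (nat \<Rightarrow> real) \<Rightarrow> real" where
  "inner_d d l x = (\<Sum>i<d. l i * x i)"

definition expo :: "nat \<Rightarrow> (nat \<Rightarrow> real) \<Rightarrow> (nat \<Rightarrow> real) \<Rightarrow> complex" where
  "expo d l x = cis (2 * pi * inner_d d l x)"

definition L2 :: "'a measure \<Rightarrow> ('a \<Rightarrow> complex) set" where
  "L2 M = {f. f \<in> borel_measurable M \<and> integrable M (\<lambda>x. (cmod (f x))\<^sup>2)}"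

definition L2_norm_sq :: "'a measure \<Rightarrow> ('a \<Rightarrow> complex) \<Rightarrow> real" where
  "L2_norm_sq M f = (\<integral>x. (cmod (f x))\<^sup>2 \<partial>M)"

definition L2_inner :: "'a measure \<Rightarrow> ('a \<Rightarrow> complex) \<Rightarrow> ('a \<Rightarrow> complex) \<Rightarrow> complex" where
  "L2_inner M f g = (\<integral>x. f x * cnj (g x) \<partial>M)"

definition fourier_frame :: "nat \<Rightarrow> (nat \<Rightarrow> real) measure \<Rightarrow> (nat \<Rightarrow> real) set \<Rightarrow> bool" where
  "fourier_frame d M \<Lambda> \<longleftrightarrow>
     (\<exists>A B :: real. 0 < A \<and> 0 < B \<and> (\<forall>f\<in>L2 M.
        (\<lambda>l. (cmod (L2_inner M f (expo d l)))\<^sup>2) summable_on \<Lambda> \<and>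
        A * L2_norm_sq M f \<le> (\<Sum>\<^sub>\<infinity>l\<in>\<Lambda>. (cmod (L2_inner M f (expo d l)))\<^sup>2) \<and>
        (\<Sum>\<^sub>\<infinity>l\<in>\<Lambda>. (cmod (L2_inner M f (expo d l)))\<^sup>2) \<le> B * L2_norm_sq M f))"

definition admits_fourier_frame :: "nat \<Rightarrow> (nat \<Rightarrow> real) measure \<Rightarrow> bool" where
  "admits_fourier_frame d M \<longleftrightarrow>
     (\<exists>\<Lambda>. countable \<Lambda> \<and> \<Lambda> \<subseteq> space (euclid d) \<and> fourier_frame d M \<Lambda>)"

end

theory Submission
  imports Defs "HOL-Probability.Probability"
begin

text \<open>
  Write \<open>F\<close>, \<open>G\<close> for the restrictions of \<open>f\<close> to the two cubes. A frequency in \<open>\<real>\<^sup>d\<close> contributes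
  \<open>|F^(\<mu>) + G^(\<nu>)|\<^sup>2\<close>, where \<open>\<mu>\<close> and \<open>\<nu>\<close> are its projections to the two coordinate planes. For every
  \<open>n \<in> \<int>\<^sup>j\<close> the frame has two frequencies: they have the same first projection \<open>u n \<in> \<int>\<^sup>k\<close>, and their
  second projections are \<open>n\<close> and the point \<open>n'\<close> obtained by replacing the last coordinate \<open>m\<close> of
  \<open>n\<close> by \<open>1/2 - m\<close>. Since neither plane is everything, each has a coordinate which the other lacks,
  so \<open>u\<close> can be chosen as a bijection \<open>\<int>\<^sup>j \<rightarrow> \<int>\<^sup>k\<close> fixing the common coordinates. By Parseval the
  sequences \<open>F^(u n)\<close>, \<open>G^(n)\<close> and \<open>G^(n')\<close> have energies \<open>\<parallel>F\<parallel>\<^sup>2\<close>, \<open>\<parallel>G\<parallel>\<^sup>2\<close> and \<open>\<parallel>G\<parallel>\<^sup>2\<close>. Moreover \<open>G^(n')\<close> is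
  the Fourier coefficient at \<open>n\<close> of \<open>RG\<close>, where \<open>R\<close> is unitary with \<open>R\<^sup>2 = -1\<close>, so that
  \<open>G^(n) - G^(n')\<close> has energy \<open>\<parallel>G - RG\<parallel>\<^sup>2 = 2\<parallel>G\<parallel>\<^sup>2\<close>. Hence the part of the \<open>G\<close>-sequence that is not
  constant on pairs controls \<open>\<parallel>G\<parallel>\<close>, and then \<open>\<parallel>F\<parallel>\<close> is controlled as well.
\<close>

subsection \<open>Square-integrable functions and Parseval systems\<close>

lemma borel_measurable_cnj [measurable (raw)]:
  "f \<in> borel_measurable M \<Longrightarrow> (\<lambda>x. cnj (f x)) \<in> borel_measurable M"
  by (rule borel_measurable_continuous_on[OF continuous_on_cnj[OF continuous_on_id]])

lemma cmod_add_sq_le: "(cmod (a + b))\<^sup>2 \<le> 2 * (cmod a)\<^sup>2 + 2 * (cmod b)\<^sup>2"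
proof -
  have "(cmod (a + b))\<^sup>2 \<le> (cmod a + cmod b)\<^sup>2"
    by (simp add: norm_triangle_ineq power_mono)
  also have "\<dots> \<le> 2 * (cmod a)\<^sup>2 + 2 * (cmod b)\<^sup>2"
    using sum_squares_bound[of "cmod a" "cmod b"] by (simp add: power2_sum)
  finally show ?thesis .
qed

lemma cmod_diff_sq_le: "(cmod (a - b))\<^sup>2 \<le> 2 * (cmod a)\<^sup>2 + 2 * (cmod b)\<^sup>2"
  using cmod_add_sq_le[of a "- b"] by simp

lemma L2_measurable: "f \<in> L2 M \<Longrightarrow> f \<in> borel_measurable M"
  and L2_integrable_sq: "f \<in> L2 M \<Longrightarrow> integrable M (\<lambda>x. (cmod (f x))\<^sup>2)"
  by (auto simp: L2_def)

lemma L2_add: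
  assumes f: "f \<in> L2 M" and g: "g \<in> L2 M"
  shows "(\<lambda>x. f x + g x) \<in> L2 M"
proof -
  note [measurable] = L2_measurable[OF f] L2_measurable[OF g]
  have "integrable M (\<lambda>x. (cmod (f x + g x))\<^sup>2)"
  proof (rule Bochner_Integration.integrable_bound)
    show "integrable M (\<lambda>x. 2 * (cmod (f x))\<^sup>2 + 2 * (cmod (g x))\<^sup>2)"
      using f g by (auto simp: L2_def)
    show "AE x in M. norm ((cmod (f x + g x))\<^sup>2) \<le> norm (2 * (cmod (f x))\<^sup>2 + 2 * (cmod (g x))\<^sup>2)"
      using cmod_add_sq_le by auto
  qed measurable
  then show ?thesis by (simp add: L2_def)
qed

lemma L2_cmult: "f \<in> L2 M \<Longrightarrow> (\<lambda>x. c * f x) \<in> L2 M"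
  by (auto simp: L2_def norm_mult power_mult_distrib)

lemma L2_diff: "f \<in> L2 M \<Longrightarrow> g \<in> L2 M \<Longrightarrow> (\<lambda>x. f x - g x) \<in> L2 M"
  using L2_add[of f M "\<lambda>x. (-1) * g x"] L2_cmult[of g M "-1"] by simp

lemma L2_sum: "(\<And>n. n \<in> S \<Longrightarrow> f n \<in> L2 M) \<Longrightarrow> (\<lambda>x. \<Sum>n\<in>S. f n x) \<in> L2 M"
proof (induction S rule: infinite_finite_induct)
  case (insert n S)
  then show ?case by (auto intro: L2_add)
qed (auto simp: L2_def)

lemma (in finite_measure) L2_bounded:
  assumes [measurable]: "f \<in> borel_measurable M" and b: "\<And>x. x \<in> space M \<Longrightarrow> cmod (f x) \<le> B"
  shows "f \<in> L2 M"
proof -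
  have "integrable M (\<lambda>x. (cmod (f x))\<^sup>2)"
    by (rule integrable_const_bound[where B="B\<^sup>2"]) (auto intro!: AE_I2 power_mono b)
  then show ?thesis by (simp add: L2_def)
qed

lemma L2_mult_cnj_integrable:
  assumes f: "f \<in> L2 M" and g: "g \<in> L2 M"
  shows "integrable M (\<lambda>x. f x * cnj (g x))"
proof -
  note [measurable] = L2_measurable[OF f] L2_measurable[OF g]
  show ?thesis
  proof (rule Bochner_Integration.integrable_bound)
    show "integrable M (\<lambda>x. (cmod (f x))\<^sup>2 + (cmod (g x))\<^sup>2)"
      using f g by (auto simp: L2_def)
    have "cmod a * cmod b \<le> (cmod a)\<^sup>2 + (cmod b)\<^sup>2" for a b
      using sum_squares_bound[of "cmod a" "cmod b"] mult_nonneg_nonneg[OF norm_ge_zero norm_ge_zero, of a b]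
      by linarith
    then show "AE x in M. norm (f x * cnj (g x)) \<le> norm ((cmod (f x))\<^sup>2 + (cmod (g x))\<^sup>2)"
      by (auto simp: norm_mult)
  qed measurable
qed

lemma L2_norm_sq_nonneg: "0 \<le> L2_norm_sq M f"
  by (simp add: L2_norm_sq_def)

text \<open>The triangle inequality for squared norms costs a factor 2; hence the tolerance
  \<open>\<epsilon> / 4\<close> in the two-stage approximations below.\<close>

lemma L2_norm_sq_diff_triangle:
  assumes "f \<in> L2 M" "g \<in> L2 M" "h \<in> L2 M"
  shows "L2_norm_sq M (\<lambda>x. f x - h x)
    \<le> 2 * L2_norm_sq M (\<lambda>x. f x - g x) + 2 * L2_norm_sq M (\<lambda>x. g x - h x)"
proof -
  note i = L2_integrable_sq[OF L2_diff[OF assms(1,2)]] L2_integrable_sq[OF L2_diff[OF assms(2,3)]]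
    L2_integrable_sq[OF L2_diff[OF assms(1,3)]]
  have "L2_norm_sq M (\<lambda>x. f x - h x)
      \<le> (\<integral>x. 2 * (cmod (f x - g x))\<^sup>2 + 2 * (cmod (g x - h x))\<^sup>2 \<partial>M)"
    unfolding L2_norm_sq_def
  proof (rule integral_mono)
    show "(cmod (f x - h x))\<^sup>2 \<le> 2 * (cmod (f x - g x))\<^sup>2 + 2 * (cmod (g x - h x))\<^sup>2" for x
      using cmod_add_sq_le[of "f x - g x" "g x - h x"] by simp
  qed (use i in auto)
  also have "\<dots> = 2 * L2_norm_sq M (\<lambda>x. f x - g x) + 2 * L2_norm_sq M (\<lambda>x. g x - h x)"
    unfolding L2_norm_sq_def using i by simp
  finally show ?thesis .
qed

text \<open>Completing the square: the coefficients \<open>a\<close> enter only through their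
  distance to the Fourier coefficients, which are therefore the optimal choice.\<close>

lemma L2_norm_sq_diff_sum:
  assumes F: "F \<in> L2 M" and S: "finite S" and e: "\<And>n. n \<in> S \<Longrightarrow> e n \<in> L2 M"
    and on: "\<And>n m. n \<in> S \<Longrightarrow> m \<in> S \<Longrightarrow> L2_inner M (e n) (e m) = (if n = m then 1 else 0)"
  shows "L2_norm_sq M (\<lambda>x. F x - (\<Sum>n\<in>S. a n * e n x)) =
    L2_norm_sq M F - (\<Sum>n\<in>S. (cmod (L2_inner M F (e n)))\<^sup>2)
      + (\<Sum>n\<in>S. (cmod (a n - L2_inner M F (e n)))\<^sup>2)"
proof -
  define c where "c n = L2_inner M F (e n)" for n
  define p where "p x = (\<Sum>n\<in>S. a n * e n x)" for x
  have iFe: "integrable M (\<lambda>x. F x * cnj (e n x))" if "n \<in> S" for n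
    using that F e by (intro L2_mult_cnj_integrable) auto
  have iee: "integrable M (\<lambda>x. e n x * cnj (e m x))" if "n \<in> S" "m \<in> S" for n m
    using that F e by (intro L2_mult_cnj_integrable) auto
  have iF: "integrable M (\<lambda>x. F x * cnj (F x))"
    using F by (intro L2_mult_cnj_integrable) auto
  have p: "p \<in> L2 M" unfolding p_def using e by (intro L2_sum L2_cmult)
  have 1: "(\<integral>x. F x * cnj (p x) \<partial>M) = (\<Sum>n\<in>S. cnj (a n) * c n)"
  proof -
    have "(\<integral>x. F x * cnj (p x) \<partial>M) = (\<integral>x. (\<Sum>n\<in>S. cnj (a n) * (F x * cnj (e n x))) \<partial>M)"
      by (simp add: p_def sum_distrib_left mult_ac)
    also have "\<dots> = (\<Sum>n\<in>S. cnj (a n) * c n)"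
      using iFe by (subst Bochner_Integration.integral_sum) (auto simp: c_def L2_inner_def)
    finally show ?thesis .
  qed
  have 2: "(\<integral>x. p x * cnj (p x) \<partial>M) = (\<Sum>n\<in>S. a n * cnj (a n))"
  proof -
    have "(\<integral>x. p x * cnj (p x) \<partial>M)
        = (\<integral>x. (\<Sum>n\<in>S. \<Sum>m\<in>S. (a n * cnj (a m)) * (e n x * cnj (e m x))) \<partial>M)"
      by (simp only: p_def cnj_sum complex_cnj_mult sum_product) (simp only: mult_ac)
    also have "\<dots> = (\<Sum>n\<in>S. \<Sum>m\<in>S. a n * cnj (a m) * L2_inner M (e n) (e m))"
      using iee by (subst Bochner_Integration.integral_sum, simp)
        (intro sum.cong refl, subst Bochner_Integration.integral_sum, auto simp: L2_inner_def)
    also have "\<dots> = (\<Sum>n\<in>S. \<Sum>m\<in>S. if n = m then a n * cnj (a m) else 0)"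
      using on by (intro sum.cong) auto
    also have "\<dots> = (\<Sum>n\<in>S. a n * cnj (a n))"
      using S by (simp add: sum.delta)
    finally show ?thesis .
  qed
  \<comment> \<open>The cross terms are complex, so the expansion is done over the complex numbers;
    both ends are real, and \<open>of_real\<close> is cancelled at the end.\<close>
  have "complex_of_real (L2_norm_sq M (\<lambda>x. F x - p x)) = (\<integral>x. (F x - p x) * cnj (F x - p x) \<partial>M)"
    unfolding L2_norm_sq_def by (simp only: complex_norm_square flip: integral_complex_of_real)
  also have "\<dots> = (\<integral>x. (F x * cnj (F x) - F x * cnj (p x)) - (cnj (F x * cnj (p x)) - p x * cnj (p x)) \<partial>M)"
    by (intro Bochner_Integration.integral_cong) (auto simp: algebra_simps)
  also have "\<dots> = (\<integral>x. F x * cnj (F x) \<partial>M) - (\<integral>x. F x * cnj (p x) \<partial>M)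
      - (cnj (\<integral>x. F x * cnj (p x) \<partial>M) - (\<integral>x. p x * cnj (p x) \<partial>M))"
  proof -
    have i: "integrable M (\<lambda>x. F x * cnj (p x))" "integrable M (\<lambda>x. p x * cnj (p x))"
      using F p by (auto intro: L2_mult_cnj_integrable)
    have j: "integrable M (\<lambda>x. cnj (F x * cnj (p x)))"
      using i(1) by (rule integrable_cnj)
    show ?thesis
      using i j iF Bochner_Integration.integral_cnj[of M "\<lambda>x. F x * cnj (p x)"]
      by (simp only: Bochner_Integration.integral_diff Bochner_Integration.integrable_diff)
  qed
  also have "\<dots> = of_real (L2_norm_sq M F) - (\<Sum>n\<in>S. c n * cnj (c n))
      + (\<Sum>n\<in>S. (a n - c n) * cnj (a n - c n))"
  proof -
    have "(\<integral>x. F x * cnj (F x) \<partial>M) = of_real (L2_norm_sq M F)"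
      unfolding L2_norm_sq_def by (simp only: complex_norm_square flip: integral_complex_of_real)
    then show ?thesis
      unfolding 1 2 by (simp add: algebra_simps sum_subtractf sum.distrib)
  qed
  also have "\<dots> = of_real (L2_norm_sq M F - (\<Sum>n\<in>S. (cmod (c n))\<^sup>2) + (\<Sum>n\<in>S. (cmod (a n - c n))\<^sup>2))"
    by (simp only: complex_norm_square of_real_add of_real_diff of_real_sum)
  finally show ?thesis unfolding c_def p_def of_real_eq_iff .
qed

text \<open>Fourier partial sums are the best approximations among all combinations of the same modes.\<close>

lemma parseval_of_approximable:
  assumes F: "F \<in> L2 M" and e: "\<And>n. e n \<in> L2 M"
    and on: "\<And>n m. L2_inner M (e n) (e m) = (if n = m then 1 else 0)"
    and approx: "\<And>\<epsilon>. \<epsilon> > 0 \<Longrightarrow>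
      \<exists>S a. finite S \<and> L2_norm_sq M (\<lambda>x. F x - (\<Sum>n\<in>S. a n * e n x)) < \<epsilon>"
  shows "((\<lambda>n. (cmod (L2_inner M F (e n)))\<^sup>2) has_sum L2_norm_sq M F) UNIV"
proof -
  let ?c = "\<lambda>n. (cmod (L2_inner M F (e n)))\<^sup>2"
  \<comment> \<open>Bessel's inequality: with the Fourier coefficients as \<open>a\<close>, the last
    sum of \<open>L2_norm_sq_diff_sum\<close> vanishes.\<close>
  have bessel: "sum ?c S \<le> L2_norm_sq M F" if "finite S" for S
    using L2_norm_sq_diff_sum[OF F that e on, of "\<lambda>n. L2_inner M F (e n)"]
      L2_norm_sq_nonneg[of M "\<lambda>x. F x - (\<Sum>n\<in>S. L2_inner M F (e n) * e n x)"] by simp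
  have "\<exists>S. finite S \<and> L2_norm_sq M F - \<epsilon> < sum ?c S" if "\<epsilon> > 0" for \<epsilon>
  proof -
    obtain S a where S: "finite S" "L2_norm_sq M (\<lambda>x. F x - (\<Sum>n\<in>S. a n * e n x)) < \<epsilon>"
      using approx[OF \<open>\<epsilon> > 0\<close>] by auto
    \<comment> \<open>Dropping this term shows that the Fourier energy on \<open>S\<close> misses
      the squared norm by no more than the error of the given approximant.\<close>
    have "0 \<le> (\<Sum>n\<in>S. (cmod (a n - L2_inner M F (e n)))\<^sup>2)" by (simp add: sum_nonneg)
    with L2_norm_sq_diff_sum[OF F S(1) e on, of a] S show ?thesis
      by (intro exI[of _ S]) auto
  qed
  note lower = this
  show ?thesis
    unfolding has_sum_def tendsto_iff
  proof (intro allI impI)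
    fix \<epsilon> :: real assume "\<epsilon> > 0"
    then obtain S where S: "finite S" "L2_norm_sq M F - \<epsilon> < sum ?c S" using lower by blast
    have "dist (sum ?c Y) (L2_norm_sq M F) < \<epsilon>" if Y: "finite Y" "S \<subseteq> Y" for Y
      using bessel[OF Y(1)] S(2) sum_mono2[OF Y, of ?c] by (simp add: dist_real_def)
    then show "\<forall>\<^sub>F Y in finite_subsets_at_top UNIV. dist (sum ?c Y) (L2_norm_sq M F) < \<epsilon>"
      using S(1) by (auto simp: eventually_finite_subsets_at_top)
  qed
qed

subsection \<open>Trigonometric polynomials on the unit interval\<close>

definition unit_interval :: "real measure" where
  "unit_interval = restrict_space lborel {0..1}"

lemma space_unit_interval [simp]: "space unit_interval = {0..1}"
  by (simp add: unit_interval_def space_restrict_space)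

lemma sets_unit_interval:
  "sets unit_interval = sets (restrict_space borel {0..1})"
  unfolding unit_interval_def by (intro sets_restrict_space_cong) simp

lemma borel_measurable_unit_interval:
  fixes f :: "real \<Rightarrow> 'a::topological_space"
  assumes "f \<in> borel_measurable borel"
  shows "f \<in> borel_measurable unit_interval"
  using measurable_restrict_space1[OF assms, of "{0..1}"]
  by (simp add: measurable_cong_sets[OF sets_unit_interval])

lemma prob_space_unit_interval: "prob_space unit_interval"
  unfolding unit_interval_def by (rule prob_space_restrict_space) auto

interpretation unit_interval: prob_space unit_interval
  by (rule prob_space_unit_interval)

text \<open>For nonzero \<open>n\<close> the integrand has a 1-periodic antiderivative, whose
  increment over the unit interval vanishes.\<close>

lemma integral_unit_interval_cis:
  "(\<integral>x. cis (2 * pi * real_of_int n * x) \<partial>unit_interval) = (if n = 0 then 1 else 0)"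
proof (cases "n = 0")
  case True
  then show ?thesis using unit_interval.prob_space by (simp add: cis_conv_exp)
next
  case False
  define F where "F x = cis (2 * pi * real_of_int n * x) / (2 * pi * \<i> * of_int n)" for x
  have "has_bochner_integral lborel
      (\<lambda>x. indicator {0..1} x *\<^sub>R cis (2 * pi * real_of_int n * x)) (F 1 - F 0)"
  proof (rule has_bochner_integral_FTC_Icc)
    show "(F has_vector_derivative cis (2 * pi * real_of_int n * x)) (at x within {0..1})" for x
    proof -
      have "((\<lambda>z. exp (2 * pi * \<i> * of_int n * z) / (2 * pi * \<i> * of_int n)) has_field_derivative
          exp (2 * pi * \<i> * of_int n * of_real x)) (at (of_real x))"
        using False by (auto intro!: derivative_eq_intros)
      from has_vector_derivative_real_field[OF this] show ?thesis
        unfolding F_def cis_conv_exp by (simp add: mult_ac)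
    qed
    show "continuous_on {0..1} (\<lambda>x. cis (2 * pi * real_of_int n * x))"
      unfolding cis_conv_exp by (intro continuous_intros)
  qed simp
  moreover have "F 1 = F 0"
    using cis_multiple_2pi[of "real_of_int n"] by (simp add: F_def mult_ac)
  ultimately show ?thesis
    using False unfolding unit_interval_def
    by (subst integral_restrict_space) (auto dest: has_bochner_integral_integral_eq)
qed

definition mode :: "int \<Rightarrow> real \<Rightarrow> complex" where
  "mode n x = cis (2 * pi * (real_of_int n * x))"

lemma mode_L2: "mode n \<in> L2 unit_interval"
proof (rule unit_interval.L2_bounded[where B=1])
  have "continuous_on UNIV (mode n)"
    unfolding mode_def cis_conv_exp by (intro continuous_intros)
  then show "mode n \<in> borel_measurable unit_interval"
    by (intro borel_measurable_unit_interval borel_measurable_continuous_onI)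
qed (simp add: mode_def)

lemma mode_orthonormal: "L2_inner unit_interval (mode n) (mode m) = (if n = m then 1 else 0)"
proof -
  have "mode n x * cnj (mode m x) = cis (2 * pi * real_of_int (n - m) * x)" for x
    by (simp add: mode_def cis_cnj cis_mult algebra_simps)
  then show ?thesis
    using integral_unit_interval_cis[of "n - m"] by (simp add: L2_inner_def)
qed

lemma mode_add: "mode (n + m) x = mode n x * mode m x"
  by (simp add: mode_def cis_mult algebra_simps)

definition trig_poly :: "(real \<Rightarrow> complex) \<Rightarrow> bool" where
  "trig_poly p \<longleftrightarrow> (\<exists>S a. finite S \<and> (\<forall>x. p x = (\<Sum>n\<in>S. a n * mode n x)))"

lemma trig_poly_mode: "trig_poly (\<lambda>x. c * mode n x)"
  unfolding trig_poly_def by (intro exI[of _ "{n}"] exI[of _ "\<lambda>_. c"]) simp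

lemma trig_poly_const: "trig_poly (\<lambda>x. c)"
  using trig_poly_mode[of c 0] by (simp add: mode_def)

lemma trig_poly_add:
  assumes "trig_poly p" "trig_poly q"
  shows "trig_poly (\<lambda>x. p x + q x)"
proof -
  obtain S a T b where "finite S" "\<And>x. p x = (\<Sum>n\<in>S. a n * mode n x)"
      "finite T" "\<And>x. q x = (\<Sum>n\<in>T. b n * mode n x)"
    using assms unfolding trig_poly_def by blast
  moreover have "(\<Sum>n\<in>S. a n * mode n x) = (\<Sum>n\<in>S\<union>T. (if n \<in> S then a n else 0) * mode n x)"
    "(\<Sum>n\<in>T. b n * mode n x) = (\<Sum>n\<in>S\<union>T. (if n \<in> T then b n else 0) * mode n x)" for x
    using \<open>finite S\<close> \<open>finite T\<close> by (auto intro!: sum.mono_neutral_cong_left)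
  ultimately show ?thesis
    unfolding trig_poly_def
    by (intro exI[of _ "S \<union> T"] exI[of _ "\<lambda>n. (if n \<in> S then a n else 0) + (if n \<in> T then b n else 0)"])
      (simp add: algebra_simps sum.distrib)
qed

lemma trig_poly_sum:
  "(\<And>i. i \<in> I \<Longrightarrow> trig_poly (p i)) \<Longrightarrow> trig_poly (\<lambda>x. \<Sum>i\<in>I. p i x)"
  by (induction I rule: infinite_finite_induct) (auto intro: trig_poly_add trig_poly_const)

lemma trig_poly_mult:
  assumes "trig_poly p" "trig_poly q"
  shows "trig_poly (\<lambda>x. p x * q x)"
proof -
  obtain S a T b where p: "\<And>x. p x = (\<Sum>n\<in>S. a n * mode n x)"
      and q: "\<And>x. q x = (\<Sum>n\<in>T. b n * mode n x)"
    using assms unfolding trig_poly_def by blast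
  have "(\<lambda>x. p x * q x) = (\<lambda>x. \<Sum>n\<in>S. \<Sum>m\<in>T. (a n * b m) * mode (n + m) x)"
    by (simp add: p q sum_product mode_add mult_ac)
  then show ?thesis by (simp only:) (intro trig_poly_sum trig_poly_mode)
qed

lemma trig_poly_L2: "trig_poly p \<Longrightarrow> p \<in> L2 unit_interval"
proof -
  assume "trig_poly p"
  then obtain S a where "\<And>x. p x = (\<Sum>n\<in>S. a n * mode n x)" unfolding trig_poly_def by blast
  then have "p = (\<lambda>x. \<Sum>n\<in>S. a n * mode n x)" by blast
  then show ?thesis by (simp only:) (intro L2_sum L2_cmult mode_L2)
qed

text \<open>Trigonometric polynomials form an algebra, so only the linear case has content: Euler's
  formulas express cosine and sine by the modes 1 and -1.\<close>

lemma real_polynomial_circle_trig_poly: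
  assumes "real_polynomial_function f"
  shows "trig_poly (\<lambda>x. of_real (f (cis (2 * pi * x))))"
  using assms
proof (induction f rule: real_polynomial_function.induct)
  case (linear f)
  interpret bounded_linear f by fact
  have f: "f z = f 1 * Re z + f \<i> * Im z" for z
  proof -
    have "f (Re z *\<^sub>R 1 + Im z *\<^sub>R \<i>) = f 1 * Re z + f \<i> * Im z"
      unfolding add scaleR by simp
    moreover have "Re z *\<^sub>R 1 + Im z *\<^sub>R \<i> = z" by (simp add: complex_eq_iff)
    ultimately show ?thesis by simp
  qed
  have "complex_of_real (f (cis t)) = of_real (f 1) * of_real (Re (cis t)) + of_real (f \<i>) * of_real (Im (cis t))" for t
    by (simp only: f[of "cis t"] of_real_add of_real_mult)
  moreover have "of_real (Re (cis t)) = (cis t + cis (- t)) / 2"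
    "of_real (Im (cis t)) = - \<i> * (cis t - cis (- t)) / 2" for t
    by (auto simp: complex_eq_iff)
  ultimately have "of_real (f (cis (2 * pi * x))) =
      ((of_real (f 1) - \<i> * of_real (f \<i>)) / 2) * mode 1 x
      + ((of_real (f 1) + \<i> * of_real (f \<i>)) / 2) * mode (-1) x" for x
    by (simp only: mode_def) (simp add: algebra_simps add_divide_distrib diff_divide_distrib)
  then show ?case by (simp only:) (intro trig_poly_add trig_poly_mode)
qed (auto intro: trig_poly_const trig_poly_add trig_poly_mult)

text \<open>A function vanishing at both ends of the unit interval descends to the circle, where it is
  uniformly approximated by polynomials in the real and imaginary part.\<close>

lemma continuous_approx_trig_poly:
  fixes g :: "real \<Rightarrow> complex"
  assumes g: "continuous_on {0..1} g" "g 0 = g 1" and e: "\<epsilon> > 0"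
  shows "\<exists>p. trig_poly p \<and> (\<forall>x\<in>{0..1}. cmod (g x - p x) < \<epsilon>)"
proof -
  let ?G = "g \<circ> (\<lambda>z. Arg2pi z / (2 * pi))"
  \<comment> \<open>The constant homotopy from the loop \<open>g\<close> to itself serves only to
    obtain continuity of \<open>?G\<close> on the circle, including at the angle 0 where
    \<open>Arg2pi\<close> jumps.\<close>
  have "homotopic_loops UNIV g g"
    using g by (simp add: homotopic_loops_refl path_def pathfinish_def pathstart_def path_image_def)
  then have "continuous_on (sphere 0 1) ?G"
    using homotopic_loops_imp_homotopic_circlemaps homotopic_with_imp_continuous by blast
  then obtain P where P: "polynomial_function P" "\<And>z. z \<in> sphere 0 1 \<Longrightarrow> cmod (?G z - P z) < \<epsilon>"
    using Stone_Weierstrass_polynomial_function[of "sphere 0 1" ?G \<epsilon>] e by auto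
  have "trig_poly (\<lambda>x. of_real (Re (P (cis (2 * pi * x)))) + \<i> * of_real (Im (P (cis (2 * pi * x)))))"
    using P(1) bounded_linear_Re bounded_linear_Im unfolding polynomial_function_def o_def
    by (intro trig_poly_add trig_poly_mult[OF trig_poly_const] real_polynomial_circle_trig_poly) auto
  then have "trig_poly (\<lambda>x. P (cis (2 * pi * x)))"
    by (simp flip: complex_eq)
  moreover have "cmod (g x - P (cis (2 * pi * x))) < \<epsilon>" if x: "x \<in> {0..1}" for x
  proof -
    have "?G (cis (2 * pi * x)) = g x"
    \<comment> \<open>\<open>Arg2pi\<close> has values in [0, 2 pi), so at \<open>x = 1\<close> it
      returns 0 and \<open>g 0 = g 1\<close> is needed.\<close>
    proof (cases "x = 1")
      case True
      then show ?thesis using g(2) Arg2pi_of_real[of 1] cis_2pi by simp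
    next
      case False
      then have "Arg2pi (cis (2 * pi * x)) = 2 * pi * x"
        using x by (intro Arg2pi_unique[of 1]) (auto simp: cis_conv_exp)
      then show ?thesis by simp
    qed
    then show ?thesis using P(2)[of "cis (2 * pi * x)"] by simp
  qed
  ultimately show ?thesis by blast
qed

subsection \<open>Parseval's identity on the unit interval\<close>

text \<open>Bridges \<open>negligible\<close>, the notion of null set behind
  \<open>measurable_on\<close>, and the Borel measure on the interval.\<close>

lemma null_sets_lebesgue_AE_unit_interval:
  assumes "negligible N"
  shows "AE x in unit_interval. x \<notin> N"
proof -
  have "AE x in lebesgue. x \<notin> N"
    using assms by (intro AE_not_in) (simp add: negligible_iff_null_sets)
  then have "AE x in lborel. x \<notin> N" by (simp add: AE_completion_iff)
  then show ?thesis
    unfolding unit_interval_def by (subst AE_restrict_space_iff) auto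
qed

lemma AE_unit_interval_interior: "AE x in unit_interval. x \<in> {0<..<1}"
proof -
  have "AE x in unit_interval. x \<notin> {0, 1}"
    by (rule null_sets_lebesgue_AE_unit_interval) simp
  moreover have "AE x in unit_interval. x \<in> {0..1}" by (rule AE_I2) simp
  ultimately show ?thesis by eventually_elim auto
qed

lemma L2_norm_sq_dominated_tendsto_0:
  assumes h: "\<And>n. h n \<in> borel_measurable M" and F: "F \<in> borel_measurable M"
    and w: "integrable M w" and bound: "\<And>n. AE x in M. (cmod (F x - h n x))\<^sup>2 \<le> w x"
    and lim: "AE x in M. (\<lambda>n. h n x) \<longlonglongrightarrow> F x"
  shows "(\<lambda>n. L2_norm_sq M (\<lambda>x. F x - h n x)) \<longlonglongrightarrow> 0"
proof -
  note [measurable] = h F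
  have "(\<lambda>n. \<integral>x. (cmod (F x - h n x))\<^sup>2 \<partial>M) \<longlonglongrightarrow> (\<integral>x. 0 \<partial>M)"
  proof (rule integral_dominated_convergence[OF _ _ w])
    show "AE x in M. (\<lambda>n. (cmod (F x - h n x))\<^sup>2) \<longlonglongrightarrow> 0"
      using lim
    proof eventually_elim
      case (elim x)
      have "(\<lambda>n. (cmod (F x - h n x))\<^sup>2) \<longlonglongrightarrow> (cmod (F x - F x))\<^sup>2"
        by (intro tendsto_intros elim)
      then show ?case by simp
    qed
    show "AE x in M. norm ((cmod (F x - h n x))\<^sup>2) \<le> w x" for n using bound[of n] by simp
  qed measurable
  then show ?thesis by (simp add: L2_norm_sq_def)
qed

text \<open>A measurable function is almost everywhere a limit of continuous functions
  \<open>g n\<close>. Clipping their values gives a bound for dominated convergence, and damping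
  them at both ends makes the end values agree, so that uniform approximation by trigonometric
  polynomials applies.\<close>

lemma bounded_approx_trig_poly:
  assumes F: "F \<in> borel_measurable unit_interval" and K: "\<And>x. cmod (F x) \<le> K" and e: "\<epsilon> > 0"
  shows "\<exists>p. trig_poly p \<and> L2_norm_sq unit_interval (\<lambda>x. F x - p x) < \<epsilon>"
proof -
  \<comment> \<open>The maximum with 1 makes the bound positive, as the division in
    \<open>clip\<close> requires.\<close>
  define L where "L = max K 1"
  have L: "L > 0" "\<And>x. cmod (F x) \<le> L" using K by (auto simp: L_def intro: max.coboundedI1)
  define F' where "F' = (\<lambda>x. indicat_real {0..1} x *\<^sub>R F x)"
  have "F' \<in> borel_measurable lborel"
    using borel_measurable_restrict_space_iff[of "{0..1}" lborel F] F unfolding F'_def unit_interval_def by simp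
  then have "F' \<in> borel_measurable lebesgue" by (intro measurable_completion)
  then have "F' measurable_on UNIV" by (intro lebesgue_measurable_imp_measurable_on) auto
  then obtain N g where N: "negligible N" and g: "\<And>n. continuous_on UNIV (g n)"
    and lim: "\<And>x. x \<notin> N \<Longrightarrow> (\<lambda>n. g n x) \<longlonglongrightarrow> F' x"
    unfolding measurable_on_def by auto
  \<comment> \<open>Radial projection onto the closed disc of radius \<open>L\<close>: continuous,
    and the identity on the values of \<open>F\<close>.\<close>
  define clip where "clip z = of_real (L / max L (cmod z)) * z" for z
  have clip_cont: "continuous_on UNIV clip"
    unfolding clip_def using L by (intro continuous_intros) auto
  have clip_le: "cmod (clip z) \<le> L" for z
  proof -
    have "cmod z / max L (cmod z) \<le> 1" using L by (simp add: divide_le_eq)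
    then have "L * (cmod z / max L (cmod z)) \<le> L * 1" using L by (intro mult_left_mono) auto
    moreover have "\<bar>L / max L (cmod z)\<bar> = L / max L (cmod z)" using L by simp
    ultimately show ?thesis unfolding clip_def norm_mult norm_of_real by simp
  qed
  have clip_id: "clip z = z" if "cmod z \<le> L" for z
    using that L by (simp add: clip_def max_def)
  \<comment> \<open>Zero at both ends of the interval, and equal to 1 for all large \<open>n\<close>
    at each interior point.\<close>
  define cutoff where "cutoff n x = min 1 (real n * (x * (1 - x)))" for n x
  define h where "h n x = of_real (cutoff n x) * clip (g n x)" for n x
  have h_cont: "continuous_on UNIV (h n)" for n
    unfolding h_def cutoff_def
    by (intro continuous_intros continuous_on_compose2[OF clip_cont] g) auto
  have h_end: "h n 0 = 0" "h n 1 = 0" for n by (auto simp: h_def cutoff_def)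
  have h_le: "cmod (h n x) \<le> L" if "x \<in> {0..1}" for n x
  proof -
    have "0 \<le> cutoff n x" "cutoff n x \<le> 1" using that by (auto simp: cutoff_def)
    then have "cutoff n x * cmod (clip (g n x)) \<le> 1 * L"
      by (intro mult_mono clip_le) auto
    then show ?thesis using \<open>0 \<le> cutoff n x\<close> by (simp add: h_def norm_mult)
  qed
  have h_lim: "(\<lambda>n. h n x) \<longlonglongrightarrow> F x" if x: "x \<in> {0<..<1}" "x \<notin> N" for x
  proof -
    have pos: "x * (1 - x) > 0" using x by simp
    have "filterlim (\<lambda>n. real n * (x * (1 - x))) at_top sequentially"
      using pos by (intro filterlim_at_top_mult_tendsto_pos[OF tendsto_const] filterlim_real_sequentially)
    then have "\<forall>\<^sub>F n in sequentially. 1 \<le> real n * (x * (1 - x))"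
      by (simp add: filterlim_at_top)
    then have "\<forall>\<^sub>F n in sequentially. clip (g n x) = h n x"
      by eventually_elim (simp add: h_def cutoff_def)
    moreover have "(\<lambda>n. clip (g n x)) \<longlonglongrightarrow> clip (F' x)"
      using clip_cont lim[OF x(2)] by (intro isCont_tendsto_compose[of _ clip]) (auto simp: continuous_on_eq_continuous_at)
    moreover have "clip (F' x) = F x" using x L by (simp add: F'_def clip_id)
    ultimately show ?thesis using Lim_transform_eventually by fastforce
  qed
  have hL2: "h n \<in> L2 unit_interval" for n
    by (rule unit_interval.L2_bounded[where B=L])
      (use h_cont h_le in \<open>auto intro!: borel_measurable_unit_interval borel_measurable_continuous_onI\<close>)
  have FL2: "F \<in> L2 unit_interval"
    by (rule unit_interval.L2_bounded[where B=L]) (use F L in auto)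
  have "(\<lambda>n. L2_norm_sq unit_interval (\<lambda>x. F x - h n x)) \<longlonglongrightarrow> 0"
  proof (rule L2_norm_sq_dominated_tendsto_0[where w="\<lambda>_. (2 * L)\<^sup>2"])
    show "AE x in unit_interval. (cmod (F x - h n x))\<^sup>2 \<le> (2 * L)\<^sup>2" for n
    proof (rule AE_I2)
      fix x assume "x \<in> space unit_interval"
      then have "cmod (F x - h n x) \<le> L + L"
        using L(2)[of x] h_le[of x n] norm_triangle_ineq4[of "F x" "h n x"] by simp
      then show "(cmod (F x - h n x))\<^sup>2 \<le> (2 * L)\<^sup>2" by (intro power_mono) auto
    qed
    show "AE x in unit_interval. (\<lambda>n. h n x) \<longlonglongrightarrow> F x"
      using null_sets_lebesgue_AE_unit_interval[OF N] AE_unit_interval_interior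
      by eventually_elim (rule h_lim)
  qed (use hL2 FL2 in \<open>auto simp: L2_def\<close>)
  then have "\<forall>\<^sub>F n in sequentially. L2_norm_sq unit_interval (\<lambda>x. F x - h n x) < \<epsilon> / 4"
    using e by (intro order_tendstoD) auto
  then obtain n where n: "L2_norm_sq unit_interval (\<lambda>x. F x - h n x) < \<epsilon> / 4"
    by (auto simp: eventually_sequentially)
  have "sqrt (\<epsilon> / 4) > 0" using e by simp
  then obtain p where p: "trig_poly p" "\<And>x. x \<in> {0..1} \<Longrightarrow> cmod (h n x - p x) < sqrt (\<epsilon> / 4)"
    using continuous_approx_trig_poly[of "h n" "sqrt (\<epsilon> / 4)"] h_cont[of n] h_end[of n]
      continuous_on_subset[of UNIV "h n" "{0..1}"] by auto
  have "L2_norm_sq unit_interval (\<lambda>x. h n x - p x) \<le> (\<integral>x. \<epsilon> / 4 \<partial>unit_interval)"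
    unfolding L2_norm_sq_def
  proof (rule integral_mono)
    show "integrable unit_interval (\<lambda>x. (cmod (h n x - p x))\<^sup>2)"
      by (intro L2_integrable_sq L2_diff hL2 trig_poly_L2 p)
    show "(cmod (h n x - p x))\<^sup>2 \<le> \<epsilon> / 4" if "x \<in> space unit_interval" for x
      using power_mono[OF less_imp_le[OF p(2)], of x 2] that e by simp
  qed simp
  also have "\<dots> = \<epsilon> / 4" using unit_interval.prob_space by simp
  finally have "L2_norm_sq unit_interval (\<lambda>x. h n x - p x) \<le> \<epsilon> / 4" .
  moreover have "L2_norm_sq unit_interval (\<lambda>x. F x - p x)
      \<le> 2 * L2_norm_sq unit_interval (\<lambda>x. F x - h n x) + 2 * L2_norm_sq unit_interval (\<lambda>x. h n x - p x)"
    by (intro L2_norm_sq_diff_triangle FL2 hL2 trig_poly_L2 p)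
  ultimately have "L2_norm_sq unit_interval (\<lambda>x. F x - p x) < \<epsilon>" using n by linarith
  then show ?thesis using p(1) by blast
qed

text \<open>Truncation at height \<open>n\<close> reduces to the bounded case; \<open>F\<close>
  itself dominates the truncation errors.\<close>

lemma L2_approx_trig_poly:
  assumes F: "F \<in> L2 unit_interval" and e: "\<epsilon> > 0"
  shows "\<exists>p. trig_poly p \<and> L2_norm_sq unit_interval (\<lambda>x. F x - p x) < \<epsilon>"
proof -
  note [measurable] = L2_measurable[OF F]
  define h where "h = (\<lambda>n x. if cmod (F x) \<le> real n then F x else 0)"
  have h[measurable]: "h n \<in> borel_measurable unit_interval" for n unfolding h_def by measurable
  have "(\<lambda>n. L2_norm_sq unit_interval (\<lambda>x. F x - h n x)) \<longlonglongrightarrow> 0"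
  proof (rule L2_norm_sq_dominated_tendsto_0[where w="\<lambda>x. (cmod (F x))\<^sup>2"])
    show "AE x in unit_interval. (\<lambda>n. h n x) \<longlonglongrightarrow> F x"
    proof (rule AE_I2)
      fix x
      have "\<forall>\<^sub>F n in sequentially. F x = h n x"
        using eventually_ge_at_top[of "nat \<lceil>cmod (F x)\<rceil>"]
        by eventually_elim (auto simp: h_def ceiling_le_iff nat_le_iff)
      then show "(\<lambda>n. h n x) \<longlonglongrightarrow> F x"
        using Lim_transform_eventually[OF tendsto_const] by fastforce
    qed
  qed (use F in \<open>auto simp: L2_def h_def\<close>)
  then have "\<forall>\<^sub>F n in sequentially. L2_norm_sq unit_interval (\<lambda>x. F x - h n x) < \<epsilon> / 4"
    using e by (intro order_tendstoD) auto
  then obtain n where n: "L2_norm_sq unit_interval (\<lambda>x. F x - h n x) < \<epsilon> / 4"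
    by (auto simp: eventually_sequentially)
  have b: "cmod (h n x) \<le> real n" for x by (auto simp: h_def)
  then obtain p where p: "trig_poly p" "L2_norm_sq unit_interval (\<lambda>x. h n x - p x) < \<epsilon> / 4"
    using bounded_approx_trig_poly[OF h, of n "real n" "\<epsilon> / 4"] e by auto
  have "h n \<in> L2 unit_interval"
    by (rule unit_interval.L2_bounded[where B="real n"]) (use b in auto)
  then have "L2_norm_sq unit_interval (\<lambda>x. F x - p x)
      \<le> 2 * L2_norm_sq unit_interval (\<lambda>x. F x - h n x) + 2 * L2_norm_sq unit_interval (\<lambda>x. h n x - p x)"
    by (rule L2_norm_sq_diff_triangle[OF F _ trig_poly_L2[OF p(1)]])
  then have "L2_norm_sq unit_interval (\<lambda>x. F x - p x) < \<epsilon>" using n p(2) by linarith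
  then show ?thesis using p(1) by blast
qed

theorem parseval_unit_interval:
  assumes F: "F \<in> L2 unit_interval"
  shows "((\<lambda>n. (cmod (L2_inner unit_interval F (mode n)))\<^sup>2) has_sum L2_norm_sq unit_interval F) UNIV"
proof (rule parseval_of_approximable[OF F mode_L2 mode_orthonormal])
  fix \<epsilon> :: real assume "\<epsilon> > 0"
  then obtain p where p: "trig_poly p" "L2_norm_sq unit_interval (\<lambda>x. F x - p x) < \<epsilon>"
    using L2_approx_trig_poly[OF F] by blast
  from p(1) obtain S a where S: "finite S" "\<And>x. p x = (\<Sum>n\<in>S. a n * mode n x)"
    unfolding trig_poly_def by blast
  show "\<exists>S a. finite S \<and> L2_norm_sq unit_interval (\<lambda>x. F x - (\<Sum>n\<in>S. a n * mode n x)) < \<epsilon>"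
    using p(2) S(1) by (intro exI[of _ S] exI[of _ a]) (simp add: S(2))
qed

subsection \<open>Parseval's identity on the cube\<close>

text \<open>Together with its converse below, this turns sums into integrals against counting
  measure, where Tonelli's theorem can exchange them with integrals over the cube.\<close>

lemma has_sum_imp_nn_integral_count_space:
  fixes f :: "'a \<Rightarrow> real"
  assumes "(f has_sum s) A" and "\<And>x. x \<in> A \<Longrightarrow> 0 \<le> f x"
  shows "(\<integral>\<^sup>+x. ennreal (f x) \<partial>count_space A) = ennreal s"
proof -
  have "f summable_on A" using assms(1) by (auto simp: summable_on_def)
  then have "Infinite_Set_Sum.abs_summable_on f A"
    using assms(2) summable_on_iff_abs_summable_on_real abs_summable_equivalent by blast
  then show ?thesis
    using assms by (simp add: nn_integral_conv_infsetsum infsetsum_infsum infsumI)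
qed

lemma nn_integral_count_space_imp_has_sum:
  fixes f :: "'a \<Rightarrow> real"
  assumes s: "(\<integral>\<^sup>+x. ennreal (f x) \<partial>count_space A) = ennreal s" "0 \<le> s"
    and f: "\<And>x. x \<in> A \<Longrightarrow> 0 \<le> f x"
  shows "(f has_sum s) A"
proof -
  have "(\<integral>\<^sup>+x. ennreal (norm (f x)) \<partial>count_space A) = ennreal s"
    unfolding s(1)[symmetric] using f by (intro nn_integral_cong) auto
  then have abs: "Infinite_Set_Sum.abs_summable_on f A"
    unfolding abs_summable_on_def by (intro integrableI_bounded) auto
  then have "f summable_on A"
    using abs_summable_equivalent abs_summable_summable by blast
  moreover have "ennreal (infsum f A) = ennreal s"
    using nn_integral_conv_infsetsum[OF abs f] s(1) infsetsum_infsum[OF abs] by simp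
  then have "infsum f A = s" using s(2) f by (simp add: infsum_nonneg)
  ultimately show ?thesis using has_sum_infsum by blast
qed

definition cube :: "'i set \<Rightarrow> ('i \<Rightarrow> real) measure" where
  "cube I = PiM I (\<lambda>_. unit_interval)"

text \<open>Frequencies are real rather than integral, because half of those in the frame have a
  last coordinate in 1/2 + Z.\<close>

definition wave :: "'i set \<Rightarrow> ('i \<Rightarrow> real) \<Rightarrow> ('i \<Rightarrow> real) \<Rightarrow> complex" where
  "wave I n x = cis (2 * pi * (\<Sum>i\<in>I. n i * x i))"

lemma prob_space_cube: "prob_space (cube I)"
  unfolding cube_def by (rule prob_space_PiM) (rule prob_space_unit_interval)

interpretation cube: prob_space "cube I" for I
  by (rule prob_space_cube)

interpretation cube_factors: product_sigma_finite "\<lambda>_. unit_interval"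
  by standard (rule unit_interval.sigma_finite_countable)

lemma measurable_cube_component: "i \<in> I \<Longrightarrow> (\<lambda>x. x i) \<in> borel_measurable (cube I)"
proof -
  assume "i \<in> I"
  then have "(\<lambda>x. x i) \<in> measurable (cube I) unit_interval"
    unfolding cube_def by (rule measurable_component_singleton)
  moreover have "(\<lambda>t. t) \<in> borel_measurable unit_interval"
    by (rule borel_measurable_unit_interval) simp
  ultimately show ?thesis by (rule measurable_compose)
qed

lemma borel_measurable_cis: "f \<in> borel_measurable M \<Longrightarrow> (\<lambda>x. cis (f x)) \<in> borel_measurable M"
  by (rule borel_measurable_continuous_on[of cis]) (auto simp: cis_conv_exp intro!: continuous_intros)

lemma wave_measurable: "wave I n \<in> borel_measurable (cube I)"
  unfolding wave_def[abs_def]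
  by (intro borel_measurable_cis borel_measurable_times borel_measurable_const borel_measurable_sum
      measurable_cube_component)

lemma wave_L2: "wave I n \<in> L2 (cube I)"
  by (rule cube.L2_bounded[where B=1]) (auto simp: wave_measurable wave_def)

lemma cube_L2_imp_integrable_wave:
  "F \<in> L2 (cube I) \<Longrightarrow> integrable (cube I) (\<lambda>x. F x * cnj (wave I n x))"
  by (intro L2_mult_cnj_integrable wave_L2)

lemma ennreal_L2_norm_sq:
  "F \<in> L2 M \<Longrightarrow> (\<integral>\<^sup>+x. ennreal ((cmod (F x))\<^sup>2) \<partial>M) = ennreal (L2_norm_sq M F)"
  unfolding L2_norm_sq_def by (intro nn_integral_eq_integral) (auto simp: L2_def)

lemma L2_of_nn_integral_finite:
  assumes "F \<in> borel_measurable M" "(\<integral>\<^sup>+x. ennreal ((cmod (F x))\<^sup>2) \<partial>M) < \<infinity>"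
  shows "F \<in> L2 M"
  using assms by (auto simp: L2_def intro!: integrableI_bounded)

text \<open>Tonelli for two counting measures, followed by reindexing along the bijection that sends
  \<open>(m, n)\<close> to \<open>n(i := m)\<close>.\<close>

lemma nn_integral_count_space_PiE_insert:
  fixes I :: "'i set"
  assumes I: "finite I" "i \<notin> I"
  shows "(\<integral>\<^sup>+m. \<integral>\<^sup>+n. f (n(i := m)) \<partial>count_space (PiE I (\<lambda>_. UNIV)) \<partial>count_space (UNIV :: int set))
    = (\<integral>\<^sup>+n. f n \<partial>count_space (PiE (insert i I) (\<lambda>_. UNIV)))"
proof -
  let ?P = "PiE I (\<lambda>_. UNIV :: int set)"
  have cnt: "countable ?P" using I by (intro countable_PiE) auto
  interpret sigma_finite_measure "count_space ?P"
    using cnt by (rule sigma_finite_measure_count_space_countable)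
  have pair: "count_space (UNIV :: int set) \<Otimes>\<^sub>M count_space ?P = count_space (UNIV \<times> ?P)"
    using cnt by (intro pair_measure_countable) auto
  have "(\<integral>\<^sup>+m. \<integral>\<^sup>+n. (\<lambda>(m, n). f (n(i := m))) (m, n) \<partial>count_space ?P \<partial>count_space UNIV)
      = (\<integral>\<^sup>+mn. (\<lambda>(m, n). f (n(i := m))) mn \<partial>(count_space UNIV \<Otimes>\<^sub>M count_space ?P))"
    by (rule nn_integral_fst) (simp add: pair)
  also have "\<dots> = (\<integral>\<^sup>+mn. f ((\<lambda>(m, n). n(i := m)) mn) \<partial>count_space (UNIV \<times> ?P))"
    by (simp add: pair case_prod_unfold)
  also have "\<dots> = (\<integral>\<^sup>+n. f n \<partial>count_space (PiE (insert i I) (\<lambda>_. UNIV)))"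
    using inj_combinator[OF I(2), of "\<lambda>_. UNIV :: int set"]
    by (intro nn_integral_bij_count_space) (simp add: bij_betw_def PiE_insert_eq)
  finally show ?thesis by simp
qed

text \<open>Induction on the index set. Parseval in the new coordinate, on almost every slice,
  replaces \<open>F\<close> by its coefficient functions \<open>H m\<close>, to which the induction
  hypothesis applies; Tonelli exchanges the sum over \<open>m\<close> with the integral over the
  remaining coordinates.\<close>

theorem parseval_cube:
  fixes F :: "('i \<Rightarrow> real) \<Rightarrow> complex"
  assumes "finite I" "F \<in> L2 (cube I)"
  shows "(\<integral>\<^sup>+n. ennreal ((cmod (L2_inner (cube I) F (wave I (\<lambda>i. real_of_int (n i)))))\<^sup>2)
      \<partial>count_space (PiE I (\<lambda>_. UNIV))) = ennreal (L2_norm_sq (cube I) F)"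
  using assms
proof (induction I arbitrary: F rule: finite_induct)
  case empty
  show ?case
    by (simp add: cube_def PiM_empty nn_integral_count_space_finite lebesgue_integral_count_space_finite
        L2_inner_def L2_norm_sq_def wave_def)
next
  case (insert i I)
  let ?hat = "\<lambda>n. (cmod (L2_inner (cube (insert i I)) F (wave (insert i I) (\<lambda>i. real_of_int (n i)))))\<^sup>2"
  have F: "F \<in> borel_measurable (PiM (insert i I) (\<lambda>_. unit_interval))"
    using L2_measurable[OF insert.prems] by (simp add: cube_def)
  have Fp: "(\<lambda>(x, t). F (x(i := t))) \<in> borel_measurable (cube I \<Otimes>\<^sub>M unit_interval)"
    unfolding cube_def using measurable_compose[OF measurable_add_dim F] by (simp add: case_prod_unfold)
  have Fx: "(\<lambda>t. F (x(i := t))) \<in> borel_measurable unit_interval" if "x \<in> space (cube I)" for x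
    using measurable_Pair2[OF Fp that] by simp
  have mode: "mode m \<in> borel_measurable unit_interval" for m
    using mode_L2 by (rule L2_measurable)
  define H where "H m x = L2_inner unit_interval (\<lambda>t. F (x(i := t))) (mode m)" for m x
  have H: "H m \<in> borel_measurable (cube I)" for m
    unfolding H_def[abs_def] L2_inner_def
  proof (rule unit_interval.borel_measurable_lebesgue_integral)
    show "(\<lambda>(x, t). F (x(i := t)) * cnj (mode m t)) \<in> borel_measurable (cube I \<Otimes>\<^sub>M unit_interval)"
      using borel_measurable_times[OF Fp borel_measurable_cnj[OF measurable_compose[OF measurable_snd mode[of m]]]]
      by (simp add: case_prod_unfold)
  qed
  \<comment> \<open>The squared norm of the slice at \<open>x\<close>, taken in the extended reals
    since it may be infinite for exceptional \<open>x\<close>.\<close>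
  define N where "N x = (\<integral>\<^sup>+t. ennreal ((cmod (F (x(i := t))))\<^sup>2) \<partial>unit_interval)" for x
  have N: "N \<in> borel_measurable (cube I)"
    unfolding N_def[abs_def]
    using unit_interval.borel_measurable_nn_integral_fst[of "\<lambda>(x, t). ennreal ((cmod (F (x(i := t))))\<^sup>2)" "cube I"] Fp
    by (simp add: case_prod_unfold)
  have NF: "(\<integral>\<^sup>+x. N x \<partial>cube I) = ennreal (L2_norm_sq (cube (insert i I)) F)"
    unfolding N_def ennreal_L2_norm_sq[OF insert.prems, symmetric] unfolding cube_def
    using F by (intro cube_factors.product_nn_integral_insert[OF insert.hyps, symmetric]) measurable
  have "AE x in cube I. N x \<noteq> \<infinity>"
    using N NF by (intro nn_integral_PInf_AE) auto
  then have "AE x in cube I. (\<integral>\<^sup>+m. ennreal ((cmod (H m x))\<^sup>2) \<partial>count_space UNIV) = N x"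
    using AE_space
  proof eventually_elim
    case (elim x)
    have "(\<lambda>t. F (x(i := t))) \<in> L2 unit_interval"
      using elim Fx by (intro L2_of_nn_integral_finite) (auto simp: N_def less_top)
    then show ?case
      using has_sum_imp_nn_integral_count_space[OF parseval_unit_interval]
      by (simp add: H_def N_def ennreal_L2_norm_sq)
  qed
  then have "(\<integral>\<^sup>+x. \<integral>\<^sup>+m. ennreal ((cmod (H m x))\<^sup>2) \<partial>count_space UNIV \<partial>cube I)
      = ennreal (L2_norm_sq (cube (insert i I)) F)"
    unfolding NF[symmetric] by (rule nn_integral_cong_AE)
  moreover have "(\<integral>\<^sup>+x. \<integral>\<^sup>+m. ennreal ((cmod (H m x))\<^sup>2) \<partial>count_space UNIV \<partial>cube I)
      = (\<integral>\<^sup>+m. \<integral>\<^sup>+x. ennreal ((cmod (H m x))\<^sup>2) \<partial>cube I \<partial>count_space UNIV)"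
    using H by (intro nn_integral_count_space_nn_integral) auto
  ultimately have sum: "(\<integral>\<^sup>+m. \<integral>\<^sup>+x. ennreal ((cmod (H m x))\<^sup>2) \<partial>cube I \<partial>count_space UNIV)
      = ennreal (L2_norm_sq (cube (insert i I)) F)" by simp
  \<comment> \<open>A finite sum has finite terms, and counting measure has no nonempty null sets,
    so every \<open>H m\<close> is square-integrable, as the induction hypothesis demands.\<close>
  have "AE m in count_space UNIV. (\<integral>\<^sup>+x. ennreal ((cmod (H m x))\<^sup>2) \<partial>cube I) \<noteq> \<infinity>"
    using sum by (intro nn_integral_PInf_AE) auto
  then have HL2: "H m \<in> L2 (cube I)" for m
    using H by (intro L2_of_nn_integral_finite) (auto simp: AE_count_space less_top)
  have hat: "L2_inner (cube I) (H m) (wave I (\<lambda>i. real_of_int (n i)))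
      = L2_inner (cube (insert i I)) F (wave (insert i I) (\<lambda>j. real_of_int ((n(i := m)) j)))" for m n
  proof -
    have w: "wave (insert i I) (\<lambda>j. real_of_int ((n(i := m)) j)) (x(i := t))
        = mode m t * wave I (\<lambda>i. real_of_int (n i)) x" for x t
    proof -
      have "(\<Sum>j\<in>I. real_of_int ((n(i := m)) j) * (x(i := t)) j) = (\<Sum>j\<in>I. real_of_int (n j) * x j)"
        using insert.hyps by (intro sum.cong) auto
      then show ?thesis
        using insert.hyps by (simp add: wave_def mode_def cis_mult distrib_left)
    qed
    \<comment> \<open>Fubini; the wave then splits into a mode in the new coordinate and a wave on
      \<open>I\<close>.\<close>
    have "L2_inner (cube (insert i I)) F (wave (insert i I) (\<lambda>j. real_of_int ((n(i := m)) j)))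
        = (\<integral>x. \<integral>t. F (x(i := t)) * cnj (wave (insert i I) (\<lambda>j. real_of_int ((n(i := m)) j)) (x(i := t)))
            \<partial>unit_interval \<partial>cube I)"
      unfolding L2_inner_def cube_def
      by (rule cube_factors.product_integral_insert[OF insert.hyps])
        (use cube_L2_imp_integrable_wave[OF insert.prems] in \<open>simp add: cube_def\<close>)
    also have "\<dots> = (\<integral>x. (\<integral>t. (F (x(i := t)) * cnj (mode m t)) * cnj (wave I (\<lambda>i. real_of_int (n i)) x)
            \<partial>unit_interval) \<partial>cube I)"
      unfolding w by (simp only: complex_cnj_mult mult.assoc)
    also have "\<dots> = L2_inner (cube I) (H m) (wave I (\<lambda>i. real_of_int (n i)))"
      unfolding L2_inner_def H_def by simp
    finally show ?thesis by simp
  qed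
  have "ennreal (L2_norm_sq (cube (insert i I)) F)
      = (\<integral>\<^sup>+m. ennreal (L2_norm_sq (cube I) (H m)) \<partial>count_space UNIV)"
    unfolding sum[symmetric] by (simp add: ennreal_L2_norm_sq[OF HL2])
  also have "\<dots> = (\<integral>\<^sup>+m. \<integral>\<^sup>+n. ennreal (?hat (n(i := m))) \<partial>count_space (PiE I (\<lambda>_. UNIV)) \<partial>count_space UNIV)"
    unfolding insert.IH[OF HL2, symmetric] hat ..
  also have "\<dots> = (\<integral>\<^sup>+n. ennreal (?hat n) \<partial>count_space (PiE (insert i I) (\<lambda>_. UNIV)))"
    by (rule nn_integral_count_space_PiE_insert[OF insert.hyps])
  finally show ?case by simp
qed

corollary parseval_cube_has_sum:
  assumes "finite I" "F \<in> L2 (cube I)"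
  shows "((\<lambda>n. (cmod (L2_inner (cube I) F (wave I (\<lambda>i. real_of_int (n i)))))\<^sup>2)
    has_sum L2_norm_sq (cube I) F) (PiE I (\<lambda>_. UNIV))"
  by (rule nn_integral_count_space_imp_has_sum[OF parseval_cube[OF assms] L2_norm_sq_nonneg]) simp

subsection \<open>Reflection in one coordinate\<close>

lemma measurable_reflect_unit_interval: "(\<lambda>t. 1 - t) \<in> measurable unit_interval unit_interval"
  unfolding unit_interval_def by (rule measurable_restrict_space3) auto

lemma distr_reflect_unit_interval: "distr unit_interval unit_interval (\<lambda>t. 1 - t) = unit_interval"
proof (rule measure_eqI)
  fix A assume "A \<in> sets (distr unit_interval unit_interval (\<lambda>t. 1 - t))"
  then have A: "A \<in> sets unit_interval" by simp
  have sub: "A \<subseteq> {0..1}" using sets.sets_into_space[OF A] by simp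
  have Ab: "A \<in> sets borel"
    using A by (simp add: sets_unit_interval sets_restrict_space_iff)
  have pre: "(\<lambda>t. 1 - t) -` A \<in> sets borel"
    using measurable_sets[of "\<lambda>t::real. 1 - t" borel borel A] Ab by simp
  have "emeasure unit_interval A = emeasure lborel A"
    using sub by (simp add: unit_interval_def emeasure_restrict_space)
  also have "\<dots> = (\<integral>\<^sup>+x. indicator A x \<partial>lborel)" using Ab by simp
  also have "\<dots> = (\<integral>\<^sup>+x. indicator A (1 + (-1) * x) \<partial>lborel)"
    using Ab by (subst nn_integral_real_affine[where c="-1" and t=1]) auto
  also have "\<dots> = (\<integral>\<^sup>+x. indicator ((\<lambda>t. 1 - t) -` A) x \<partial>lborel)"
    by (intro nn_integral_cong) (simp add: indicator_def)
  also have "\<dots> = emeasure lborel ((\<lambda>t. 1 - t) -` A)" using pre by simp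
  also have "\<dots> = emeasure unit_interval ((\<lambda>t. 1 - t) -` A \<inter> {0..1})"
  proof -
    have "(\<lambda>t. 1 - t) -` A \<inter> {0..1} = (\<lambda>t. 1 - t) -` A" using sub by force
    moreover have "(\<lambda>t. 1 - t) -` A \<subseteq> {0..1}" using sub by force
    ultimately show ?thesis by (simp add: unit_interval_def emeasure_restrict_space)
  qed
  also have "\<dots> = emeasure (distr unit_interval unit_interval (\<lambda>t. 1 - t)) A"
    using A measurable_reflect_unit_interval by (simp add: emeasure_distr)
  finally show "emeasure (distr unit_interval unit_interval (\<lambda>t. 1 - t)) A = emeasure unit_interval A"
    by simp
qed simp

definition reflect :: "'i \<Rightarrow> ('i \<Rightarrow> real) \<Rightarrow> 'i \<Rightarrow> real" where
  "reflect L x = x(L := 1 - x L)"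

lemma reflect_reflect [simp]: "reflect L (reflect L x) = x"
  by (simp add: reflect_def)

lemma measurable_reflect:
  assumes "L \<in> I"
  shows "reflect L \<in> measurable (cube I) (cube I)"
  unfolding reflect_def[abs_def] cube_def
proof (rule measurable_fun_upd[where J=I])
  have "(\<lambda>x. x L) \<in> measurable (PiM I (\<lambda>_. unit_interval)) unit_interval"
    using assms by (rule measurable_component_singleton)
  then show "(\<lambda>x. 1 - x L) \<in> measurable (PiM I (\<lambda>_. unit_interval)) unit_interval"
    by (rule measurable_compose[OF _ measurable_reflect_unit_interval])
qed (use assms in auto)

text \<open>The product measure is determined by boxes, and reflection pulls a box back to a box
  with sides of the same length.\<close>

lemma distr_reflect_cube:
  assumes I: "finite I" "L \<in> I"
  shows "distr (cube I) (cube I) (reflect L) = cube I"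
  unfolding cube_def
proof (rule cube_factors.PiM_eqI[OF I(1)])
  fix A :: "'a \<Rightarrow> real set"
  assume A: "\<And>i. i \<in> I \<Longrightarrow> A i \<in> sets unit_interval"
  \<comment> \<open>The preimage box; the intersection keeps its \<open>L\<close>-th side inside the
    unit interval.\<close>
  define B where "B = A(L := (\<lambda>t. 1 - t) -` A L \<inter> {0..1})"
  have BL: "B L \<in> sets unit_interval"
    using measurable_sets[OF measurable_reflect_unit_interval A[OF I(2)]] by (simp add: B_def)
  have em: "emeasure unit_interval (B i) = emeasure unit_interval (A i)" if "i \<in> I" for i
  proof (cases "i = L")
    case True
    have "emeasure (distr unit_interval unit_interval (\<lambda>t. 1 - t)) (A L) = emeasure unit_interval (B L)"
      using A[OF I(2)] measurable_reflect_unit_interval by (simp add: emeasure_distr B_def)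
    then show ?thesis using True by (simp add: distr_reflect_unit_interval)
  qed (simp add: B_def)
  have sub: "A i \<subseteq> {0..1}" if "i \<in> I" for i using sets.sets_into_space[OF A[OF that]] by simp
  have "reflect L -` PiE I A \<inter> space (PiM I (\<lambda>_. unit_interval)) = PiE I B"
  proof (rule set_eqI)
    fix x
    have "reflect L x i \<in> A i \<and> x i \<in> {0..1} \<longleftrightarrow> x i \<in> B i" if "i \<in> I" for i
      using sub[OF that] by (cases "i = L") (auto simp: reflect_def B_def)
    moreover have "reflect L x \<in> extensional I \<longleftrightarrow> x \<in> extensional I"
      using I(2) by (auto simp: reflect_def extensional_def)
    ultimately show "x \<in> reflect L -` PiE I A \<inter> space (PiM I (\<lambda>_. unit_interval)) \<longleftrightarrow> x \<in> PiE I B"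
      unfolding space_PiM PiE_iff Int_iff vimage_eq space_unit_interval by blast
  qed
  then have "emeasure (distr (PiM I (\<lambda>_. unit_interval)) (PiM I (\<lambda>_. unit_interval)) (reflect L)) (PiE I A)
      = emeasure (PiM I (\<lambda>_. unit_interval)) (PiE I B)"
    using A I measurable_reflect[of L I] by (subst emeasure_distr) (auto simp: cube_def intro!: sets_PiM_I_finite)
  also have "\<dots> = (\<Prod>i\<in>I. emeasure unit_interval (B i))"
    using I A BL by (intro cube_factors.emeasure_PiM) (auto simp: B_def)
  also have "\<dots> = (\<Prod>i\<in>I. emeasure unit_interval (A i))" using em by (intro prod.cong) auto
  finally show "emeasure (distr (PiM I (\<lambda>_. unit_interval)) (PiM I (\<lambda>_. unit_interval)) (reflect L)) (PiE I A)
      = (\<Prod>i\<in>I. emeasure unit_interval (A i))" .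
qed simp

lemma integral_reflect_cube:
  fixes f :: "_ \<Rightarrow> 'b::{banach, second_countable_topology}"
  assumes "finite I" "L \<in> I" "f \<in> borel_measurable (cube I)"
  shows "(\<integral>x. f (reflect L x) \<partial>cube I) = (\<integral>x. f x \<partial>cube I)"
  using integral_distr[OF measurable_reflect assms(3), of L] distr_reflect_cube[of I L] assms by simp

lemma integrable_reflect_cube:
  fixes f :: "_ \<Rightarrow> 'b::{banach, second_countable_topology}"
  assumes "finite I" "L \<in> I" "integrable (cube I) f"
  shows "integrable (cube I) (\<lambda>x. f (reflect L x))"
  using integrable_distr[OF measurable_reflect, of L I f] distr_reflect_cube[of I L] assms by simp

text \<open>Replacing the frequency \<open>n\<close> by \<open>1/2 - n\<close> in the coordinate \<open>L\<close> amounts to replacing \<open>F\<close> by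
  \<open>twist L F\<close>. This operator is unitary with square \<open>-1\<close>, so \<open>F\<close> and \<open>twist L F\<close> have purely
  imaginary inner product.\<close>

definition twist :: "'i \<Rightarrow> (('i \<Rightarrow> real) \<Rightarrow> complex) \<Rightarrow> ('i \<Rightarrow> real) \<Rightarrow> complex" where
  "twist L F x = - cis (pi * x L) * F (reflect L x)"

lemma twist_L2:
  assumes I: "finite I" "L \<in> I" and F: "F \<in> L2 (cube I)"
  shows "twist L F \<in> L2 (cube I)"
proof -
  have "twist L F \<in> borel_measurable (cube I)"
    unfolding twist_def[abs_def]
    by (intro borel_measurable_times borel_measurable_uminus borel_measurable_cis borel_measurable_const
        measurable_cube_component I measurable_compose[OF measurable_reflect L2_measurable[OF F]])
  moreover have "integrable (cube I) (\<lambda>x. (cmod (twist L F x))\<^sup>2)"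
    using integrable_reflect_cube[OF I L2_integrable_sq[OF F]] by (simp add: twist_def norm_mult)
  ultimately show ?thesis by (simp add: L2_def)
qed

lemma L2_norm_sq_twist:
  assumes I: "finite I" "L \<in> I" and F: "F \<in> L2 (cube I)"
  shows "L2_norm_sq (cube I) (twist L F) = L2_norm_sq (cube I) F"
  using integral_reflect_cube[OF I borel_measurable_integrable[OF L2_integrable_sq[OF F]]]
  by (simp add: L2_norm_sq_def twist_def norm_mult)

text \<open>The identity behind the square being -1: the sign from \<open>cis pi\<close> cancels the
  one in \<open>twist\<close>, leaving the conjugate phase.\<close>

lemma twist_reflect: "twist L F (reflect L x) = cnj (cis (pi * x L)) * F x"
proof -
  have "cis (pi * (1 - x L)) = - cnj (cis (pi * x L))"
    by (simp add: complex_eq_iff right_diff_distrib cos_diff sin_diff)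
  then show ?thesis unfolding twist_def reflect_reflect by (simp add: reflect_def)
qed

lemma cmod_parallelogram: "(cmod (a + b))\<^sup>2 + (cmod (a - b))\<^sup>2 = 2 * (cmod a)\<^sup>2 + 2 * (cmod b)\<^sup>2"
  unfolding cmod_power2 by (simp add: power2_eq_square algebra_simps)

text \<open>The cross term takes opposite values at \<open>x\<close> and at
  \<open>reflect L x\<close>. Adding the two points gives a parallelogram identity, and invariance
  under reflection then doubles both integrals.\<close>

lemma L2_norm_sq_diff_twist:
  assumes I: "finite I" "L \<in> I" and F: "F \<in> L2 (cube I)"
  shows "L2_norm_sq (cube I) (\<lambda>x. F x - twist L F x) = 2 * L2_norm_sq (cube I) F"
proof -
  let ?g = "\<lambda>x. (cmod (F x - twist L F x))\<^sup>2" and ?f = "\<lambda>x. (cmod (F x))\<^sup>2"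
  have g: "integrable (cube I) ?g" by (intro L2_integrable_sq L2_diff F twist_L2 I)
  have f: "integrable (cube I) ?f" by (intro L2_integrable_sq F)
  have pt: "?g x + ?g (reflect L x) = 2 * ?f x + 2 * ?f (reflect L x)" for x
  proof -
    define u where "u = cis (pi * x L)"
    have u: "cmod u = 1" "u * cnj u = 1" by (simp_all add: u_def cis_cnj cis_mult)
    \<comment> \<open>Multiplying by the unit \<open>u\<close> brings the difference at the
      reflected point to the form needed for the parallelogram law.\<close>
    have "cmod (F (reflect L x) - cnj u * F x) = cmod (u * (F (reflect L x) - cnj u * F x))"
      using u by (simp add: norm_mult)
    also have "u * (F (reflect L x) - cnj u * F x) = - (F x - u * F (reflect L x))"
      using u(2) by (simp add: algebra_simps flip: mult.assoc)
    finally have "?g (reflect L x) = (cmod (F x - u * F (reflect L x)))\<^sup>2"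
      by (simp add: twist_reflect u_def norm_minus_commute)
    moreover have "?g x = (cmod (F x + u * F (reflect L x)))\<^sup>2" by (simp add: twist_def u_def)
    ultimately show ?thesis
      using cmod_parallelogram[of "F x" "u * F (reflect L x)"] u by (simp add: norm_mult)
  qed
  have "(\<integral>x. ?g x + ?g (reflect L x) \<partial>cube I) = (\<integral>x. 2 * ?f x + 2 * ?f (reflect L x) \<partial>cube I)"
    unfolding pt ..
  moreover have "(\<integral>x. ?g x + ?g (reflect L x) \<partial>cube I) = 2 * (\<integral>x. ?g x \<partial>cube I)"
    using g integrable_reflect_cube[OF I g] integral_reflect_cube[OF I borel_measurable_integrable[OF g]]
    by (subst Bochner_Integration.integral_add) auto
  moreover have "(\<integral>x. 2 * ?f x + 2 * ?f (reflect L x) \<partial>cube I) = 4 * (\<integral>x. ?f x \<partial>cube I)"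
    using f integrable_reflect_cube[OF I f] integral_reflect_cube[OF I borel_measurable_integrable[OF f]]
    by (subst Bochner_Integration.integral_add) auto
  ultimately show ?thesis by (simp add: L2_norm_sq_def)
qed

text \<open>Substituting the reflection in the integral sends the phase (1/2 - n)(1 - x) to nx - x/2
  + 1/2 - n, where the integer n has no effect on the exponential.\<close>

lemma L2_inner_twist:
  fixes n :: "'i \<Rightarrow> int"
  assumes I: "finite I" "L \<in> I" and F: "F \<in> L2 (cube I)"
  shows "L2_inner (cube I) (twist L F) (wave I (\<lambda>i. real_of_int (n i)))
    = L2_inner (cube I) F (wave I ((\<lambda>i. real_of_int (n i))(L := 1 / 2 - real_of_int (n L))))"
proof -
  let ?n = "\<lambda>i. real_of_int (n i)"
  let ?m = "?n(L := 1 / 2 - ?n L)"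
  have w: "wave I ?m (reflect L x) = - cnj (cis (pi * x L)) * wave I ?n x" for x
  proof -
    let ?s = "\<Sum>i\<in>I - {L}. ?n i * x i"
    have 1: "(\<Sum>i\<in>I. ?m i * reflect L x i) = (1 / 2 - ?n L) * (1 - x L) + ?s"
      unfolding sum.remove[OF I] by (simp add: reflect_def)
    have 2: "(\<Sum>i\<in>I. ?n i * x i) = ?n L * x L + ?s" by (rule sum.remove[OF I])
    have "wave I ?m (reflect L x)
        = cis (pi + (- (pi * x L) + (2 * pi * (\<Sum>i\<in>I. ?n i * x i) + 2 * pi * real_of_int (- n L))))"
      unfolding wave_def 1 2 by (rule arg_cong[where f=cis]) (simp add: algebra_simps diff_divide_distrib)
    also have "\<dots> = cis pi * (cnj (cis (pi * x L)) * (wave I ?n x * cis (2 * pi * real_of_int (- n L))))"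
      by (simp only: cis_mult[symmetric] wave_def cis_cnj)
    also have "cis (2 * pi * real_of_int (- n L)) = 1" by (rule cis_multiple_2pi) simp
    also have "cis pi * (cnj (cis (pi * x L)) * (wave I ?n x * 1)) = - cnj (cis (pi * x L)) * wave I ?n x"
      by simp
    finally show ?thesis .
  qed
  have "L2_inner (cube I) F (wave I ?m) = (\<integral>x. F (reflect L x) * cnj (wave I ?m (reflect L x)) \<partial>cube I)"
    unfolding L2_inner_def
    by (rule integral_reflect_cube[OF I borel_measurable_integrable[OF cube_L2_imp_integrable_wave[OF F, of ?m]], symmetric])
  also have "\<dots> = L2_inner (cube I) (twist L F) (wave I ?n)"
    unfolding L2_inner_def w twist_def by (simp add: mult_ac)
  finally show ?thesis by simp
qed

subsection \<open>Integration with respect to a sum of measures\<close>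

lemma space_add_measure [simp]: "space (add_measure M N) = space M"
  and sets_add_measure [simp]: "sets (add_measure M N) = sets M"
  by (simp_all add: add_measure_def)

lemma emeasure_add_measure:
  assumes "sets N = sets M" "A \<in> sets M"
  shows "emeasure (add_measure M N) A = emeasure M A + emeasure N A"
proof (rule emeasure_measure_of[OF add_measure_def])
  show "countably_additive (sets (add_measure M N)) (\<lambda>A. emeasure M A + emeasure N A)"
  proof (rule countably_additiveI)
    fix A :: "nat \<Rightarrow> 'a set"
    assume "range A \<subseteq> sets (add_measure M N)" "disjoint_family A"
    then show "(\<Sum>i. emeasure M (A i) + emeasure N (A i)) = emeasure M (\<Union>i. A i) + emeasure N (\<Union>i. A i)"
      using assms(1) by (simp add: suminf_add[symmetric] suminf_emeasure)
  qed
qed (use assms sets.space_closed in \<open>auto simp: positive_def\<close>)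

lemma borel_measurable_sets_eq:
  "sets N = sets M \<Longrightarrow> f \<in> borel_measurable M \<Longrightarrow> f \<in> borel_measurable N"
  using measurable_cong_sets[of N M borel borel] by simp

lemma nn_integral_add_measure:
  assumes s: "sets N = sets M" and f: "f \<in> borel_measurable M"
  shows "(\<integral>\<^sup>+x. f x \<partial>add_measure M N) = (\<integral>\<^sup>+x. f x \<partial>M) + (\<integral>\<^sup>+x. f x \<partial>N)"
  using f
proof (induct rule: borel_measurable_induct)
  case (cong f g)
  have "integral\<^sup>N K f = integral\<^sup>N K g" if "space K = space M" for K
    using cong(3) that by (intro nn_integral_cong) auto
  then show ?case
    using cong(4) sets_eq_imp_space_eq[OF s] by simp
next
  case (set A)
  then show ?case using s by (simp add: emeasure_add_measure)
next
  case (mult u c)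
  note [measurable] = mult(2)
  have "u \<in> borel_measurable N" "u \<in> borel_measurable (add_measure M N)"
    using mult(2) s by (auto intro: borel_measurable_sets_eq[of _ M])
  then show ?case using mult by (simp add: nn_integral_cmult distrib_left)
next
  case (add u v)
  have "u \<in> borel_measurable N" "u \<in> borel_measurable (add_measure M N)"
    "v \<in> borel_measurable N" "v \<in> borel_measurable (add_measure M N)"
    using add s by (auto intro: borel_measurable_sets_eq[of _ M])
  then show ?case using add by (simp add: nn_integral_add ac_simps)
next
  case (seq U)
  have U: "U i \<in> borel_measurable N" "U i \<in> borel_measurable (add_measure M N)" for i
    using seq s by (auto intro: borel_measurable_sets_eq[of _ M])
  have "incseq (\<lambda>i. \<integral>\<^sup>+x. U i x \<partial>M)" "incseq (\<lambda>i. \<integral>\<^sup>+x. U i x \<partial>N)"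
    using \<open>incseq U\<close> by (auto simp: incseq_def le_fun_def intro!: nn_integral_mono)
  then have add: "(SUP i. (\<integral>\<^sup>+x. U i x \<partial>M) + (\<integral>\<^sup>+x. U i x \<partial>N))
      = (SUP i. \<integral>\<^sup>+x. U i x \<partial>M) + (SUP i. \<integral>\<^sup>+x. U i x \<partial>N)"
    by (rule ennreal_SUP_add)
  have conv: "(\<integral>\<^sup>+x. (SUP i. U i) x \<partial>K) = (SUP i. \<integral>\<^sup>+x. U i x \<partial>K)"
    if "\<And>i. U i \<in> borel_measurable K" for K
    unfolding SUP_apply using \<open>incseq U\<close> that by (rule nn_integral_monotone_convergence_SUP)
  have "(SUP i. \<integral>\<^sup>+x. U i x \<partial>add_measure M N)
      = (SUP i. (\<integral>\<^sup>+x. U i x \<partial>M) + (\<integral>\<^sup>+x. U i x \<partial>N))"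
    using seq by (intro SUP_cong) auto
  then show ?case
    unfolding conv[OF U(1)] conv[OF U(2)] conv[OF seq(1)] add .
qed

lemma integrable_add_measure:
  fixes f :: "'a \<Rightarrow> 'b::{banach, second_countable_topology}"
  assumes s: "sets N = sets M" and f: "integrable (add_measure M N) f"
  shows "integrable M f" "integrable N f"
proof -
  have m: "f \<in> borel_measurable M" "f \<in> borel_measurable N"
    using borel_measurable_integrable[OF f] s by (auto intro: borel_measurable_sets_eq[of _ "add_measure M N"])
  have "(\<integral>\<^sup>+x. ennreal (norm (f x)) \<partial>add_measure M N) < \<infinity>"
    using f by (simp add: integrable_iff_bounded)
  then show "integrable M f" "integrable N f"
    using m by (auto simp: nn_integral_add_measure[OF s] integrable_iff_bounded)
qed

lemma integral_add_measure:
  fixes f :: "'a \<Rightarrow> 'b::{banach, second_countable_topology}"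
  assumes s: "sets N = sets M" and f: "integrable (add_measure M N) f"
  shows "(\<integral>x. f x \<partial>add_measure M N) = (\<integral>x. f x \<partial>M) + (\<integral>x. f x \<partial>N)"
  using f
proof (induct rule: integrable_induct)
  case (base A c)
  then have A: "A \<in> sets M" "A \<in> sets N" using s by auto
  have fin: "emeasure M A < \<infinity>" "emeasure N A < \<infinity>"
    using base A by (auto simp: emeasure_add_measure[OF s])
  have "measure (add_measure M N) A = measure M A + measure N A"
    using fin A by (simp add: measure_def emeasure_add_measure[OF s] enn2real_plus)
  then show ?case using A base fin by (simp add: scaleR_left_distrib)
next
  case (add f g)
  then show ?case using integrable_add_measure[OF s add(1)] integrable_add_measure[OF s add(3)] by simp
next
  case (lim f h)
  have sp: "space N = space M" using s by (rule sets_eq_imp_space_eq)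
  note hi = integrable_add_measure[OF s lim(1)] and fi = integrable_add_measure[OF s lim(5)]
  \<comment> \<open>Stated for a general \<open>K\<close>, since it serves \<open>M\<close>,
    \<open>N\<close> and their sum alike.\<close>
  have conv: "(\<lambda>i. \<integral>x. h i x \<partial>K) \<longlonglongrightarrow> (\<integral>x. f x \<partial>K)"
    if K: "space K = space M" "\<And>i. integrable K (h i)" "integrable K f" for K
  proof (rule integral_dominated_convergence[where w="\<lambda>x. 2 * norm (f x)"])
    show "AE x in K. (\<lambda>i. h i x) \<longlonglongrightarrow> f x" using lim(3) K(1) by (intro AE_I2) auto
    show "AE x in K. norm (h i x) \<le> 2 * norm (f x)" for i using lim(4) K(1) by (intro AE_I2) auto
  qed (use K in auto)
  have "(\<lambda>i. \<integral>x. h i x \<partial>add_measure M N) \<longlonglongrightarrow> (\<integral>x. f x \<partial>M) + (\<integral>x. f x \<partial>N)"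
    unfolding lim(2) by (intro tendsto_add conv) (use sp hi fi in auto)
  moreover have "(\<lambda>i. \<integral>x. h i x \<partial>add_measure M N) \<longlonglongrightarrow> (\<integral>x. f x \<partial>add_measure M N)"
    by (intro conv) (use lim in auto)
  ultimately show ?case using LIMSEQ_unique by blast
qed

subsection \<open>Sums of two cube measures\<close>

text \<open>The unknown \<open>a\<close> cancels in the difference of \<open>a + b\<close> and
  \<open>a + b'\<close>, so \<open>S\<close> and \<open>S'\<close> control the energy of
  \<open>b - b'\<close>, hence \<open>B\<close>; then \<open>a = (a + b) - b\<close> controls
  \<open>A\<close>.\<close>

lemma paired_frame_bounds:
  fixes a b b' :: "'a \<Rightarrow> complex"
  assumes a: "((\<lambda>n. (cmod (a n))\<^sup>2) has_sum A) Z"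
    and b: "((\<lambda>n. (cmod (b n))\<^sup>2) has_sum B) Z"
    and b': "((\<lambda>n. (cmod (b' n))\<^sup>2) has_sum B) Z"
    and d: "((\<lambda>n. (cmod (b n - b' n))\<^sup>2) has_sum 2 * B) Z"
  obtains S S' where "((\<lambda>n. (cmod (a n + b n))\<^sup>2) has_sum S) Z"
    "((\<lambda>n. (cmod (a n + b' n))\<^sup>2) has_sum S') Z"
    "A + B \<le> 5 * (S + S')" "S + S' \<le> 4 * (A + B)"
proof -
  have summable: "(\<lambda>n. (cmod (a n + c n))\<^sup>2) summable_on Z"
    if "((\<lambda>n. (cmod (c n))\<^sup>2) has_sum B) Z" for c
  proof (rule summable_on_comparison_test)
    show "(\<lambda>n. 2 * (cmod (a n))\<^sup>2 + 2 * (cmod (c n))\<^sup>2) summable_on Z"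
      using has_sum_add[OF has_sum_cmult_right[OF a, of 2] has_sum_cmult_right[OF that, of 2]]
      by (auto simp: summable_on_def)
  qed (use cmod_add_sq_le in auto)
  obtain S where S: "((\<lambda>n. (cmod (a n + b n))\<^sup>2) has_sum S) Z"
    using summable[OF b] by (auto simp: summable_on_def)
  obtain S' where S': "((\<lambda>n. (cmod (a n + b' n))\<^sup>2) has_sum S') Z"
    using summable[OF b'] by (auto simp: summable_on_def)
  have "S \<le> 2 * A + 2 * B"
    by (rule has_sum_mono[OF S has_sum_add[OF has_sum_cmult_right[OF a] has_sum_cmult_right[OF b]]])
      (rule cmod_add_sq_le)
  moreover have "S' \<le> 2 * A + 2 * B"
    by (rule has_sum_mono[OF S' has_sum_add[OF has_sum_cmult_right[OF a] has_sum_cmult_right[OF b']]])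
      (rule cmod_add_sq_le)
  moreover have "2 * B \<le> 2 * S + 2 * S'"
  proof (rule has_sum_mono[OF d has_sum_add[OF has_sum_cmult_right[OF S] has_sum_cmult_right[OF S']]])
    show "(cmod (b n - b' n))\<^sup>2 \<le> 2 * (cmod (a n + b n))\<^sup>2 + 2 * (cmod (a n + b' n))\<^sup>2" for n
      using cmod_diff_sq_le[of "a n + b n" "a n + b' n"] by simp
  qed
  moreover have "A \<le> 2 * S + 2 * B"
  proof (rule has_sum_mono[OF a has_sum_add[OF has_sum_cmult_right[OF S] has_sum_cmult_right[OF b]]])
    show "(cmod (a n))\<^sup>2 \<le> 2 * (cmod (a n + b n))\<^sup>2 + 2 * (cmod (b n))\<^sup>2" for n
      using cmod_diff_sq_le[of "a n + b n" "b n"] by simp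
  qed
  moreover have "0 \<le> S'" by (rule has_sum_nonneg[OF S']) simp
  \<comment> \<open>From \<open>B \<le> S + S'\<close> and \<open>A \<le> 2 * S + 2 * B\<close>
    comes \<open>A + B \<le> 5 * S + 3 * S'\<close>; the upper constant adds the bounds for
    \<open>S\<close> and \<open>S'\<close>.\<close>
  ultimately have "A + B \<le> 5 * (S + S')" "S + S' \<le> 4 * (A + B)" by argo+
  then show ?thesis by (rule that[OF S S'])
qed

lemma ex_bij_betw_int_lattices:
  fixes I :: "'i set" and J :: "'j set"
  assumes "finite I" "I \<noteq> {}" "finite J" "J \<noteq> {}"
  obtains \<phi> where "bij_betw \<phi> (PiE I (\<lambda>_. UNIV :: int set)) (PiE J (\<lambda>_. UNIV :: int set))"
proof -
  have "countable (PiE I (\<lambda>_. UNIV :: int set))" "countable (PiE J (\<lambda>_. UNIV :: int set))"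
    using assms by (auto intro!: countable_PiE)
  moreover have "infinite (PiE I (\<lambda>_. UNIV :: int set))" "infinite (PiE J (\<lambda>_. UNIV :: int set))"
    using assms infinite_UNIV_int by (auto simp: finite_PiE_iff PiE_eq_empty_iff)
  ultimately show ?thesis
    using that bij_betw_trans[OF to_nat_on_infinite bij_betw_from_nat_into] by blast
qed

text \<open>A frequency has a single value at each coordinate common to both planes, so its
  projections must agree there. The other coordinates of \<open>n\<close> are matched with those of
  the first plane by an arbitrary bijection of countably infinite lattices.\<close>

lemma ex_compatible_bij:
  assumes "j < d" "1 \<le> j" "1 \<le> k" "k < d"
  obtains u :: "(nat \<Rightarrow> int) \<Rightarrow> nat \<Rightarrow> int"
    where "bij_betw u (PiE {..<j} (\<lambda>_. UNIV)) (PiE {..<k} (\<lambda>_. UNIV))"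
      and "\<And>n i. i < k \<Longrightarrow> d - j \<le> i \<Longrightarrow> u n i = n (i - (d - j))"
proof -
  txt \<open>\<open>r\<close> coordinates are shared by the two planes (none if \<open>k \<le> d - j\<close>, by truncation), and \<open>p\<close>
    belong to the first plane only.\<close>
  define r where "r = k - (d - j)"
  define p where "p = k - r"
  have rp: "r < j" "0 < p" "r + p = k" "r = 0 \<or> p = d - j" "p \<le> d - j"
    using assms by (auto simp: r_def p_def)
  let ?B = "PiE {r..<j} (\<lambda>_. UNIV :: int set)" and ?A = "PiE {..<p} (\<lambda>_. UNIV :: int set)"
  \<comment> \<open>Both index sets are nonempty: \<open>r < j\<close> because \<open>k < d\<close>,
    and \<open>0 < p\<close> because \<open>j < d\<close>.\<close>
  obtain \<phi> where \<phi>: "bij_betw \<phi> ?B ?A"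
    using ex_bij_betw_int_lattices[of "{r..<j}" "{..<p}"] rp by auto
  define u where "u n = (\<lambda>i\<in>{..<k}. if i < p then \<phi> (restrict n {r..<j}) i else n (i - p))"
    for n :: "nat \<Rightarrow> int"
  have \<phi>_u: "\<phi> (restrict n {r..<j}) = restrict (u n) {..<p}" for n
  proof -
    have "\<phi> (restrict n {r..<j}) \<in> ?A" using bij_betwE[OF \<phi>] by simp
    then show ?thesis using rp by (auto simp: u_def PiE_iff extensional_def fun_eq_iff)
  qed
  have "inj_on u (PiE {..<j} (\<lambda>_. UNIV))"
  proof (rule inj_onI)
    fix n n' :: "nat \<Rightarrow> int"
    assume n: "n \<in> PiE {..<j} (\<lambda>_. UNIV)" "n' \<in> PiE {..<j} (\<lambda>_. UNIV)" and eq: "u n = u n'"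
    have "restrict n {r..<j} = restrict n' {r..<j}"
      by (rule inj_onD[OF bij_betw_imp_inj_on[OF \<phi>]]) (auto simp: \<phi>_u eq)
    then have hi: "n i = n' i" if "r \<le> i" "i < j" for i
      using that by (metis atLeastLessThan_iff restrict_apply')
    have lo: "n i = n' i" if "i < r" for i
      using fun_cong[OF eq, of "i + p"] that rp by (simp add: u_def)
    show "n = n'"
      using n by (rule PiE_ext) (use hi lo in \<open>metis lessThan_iff not_less\<close>)
  qed
  moreover have "u ` PiE {..<j} (\<lambda>_. UNIV) = PiE {..<k} (\<lambda>_. UNIV)"
  proof (intro equalityI subsetI)
    fix w :: "nat \<Rightarrow> int" assume w: "w \<in> PiE {..<k} (\<lambda>_. UNIV)"
    obtain v where v: "v \<in> ?B" "\<phi> v = restrict w {..<p}"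
      using bij_betw_imp_surj_on[OF \<phi>] by (metis (no_types, lifting) imageE restrict_PiE_iff UNIV_I)
    \<comment> \<open>The inverse of \<open>u\<close>: shared coordinates are read off from
      \<open>w\<close>, the others come from \<phi>.\<close>
    define n where "n = (\<lambda>i\<in>{..<j}. if i < r then w (i + p) else v i)"
    have rn: "restrict n {r..<j} = v"
      using v(1) by (auto simp: n_def PiE_iff extensional_def fun_eq_iff)
    have "u n i = w i" for i
    proof (cases "i < k")
      case True
      show ?thesis
      proof (cases "i < p")
        case True
        then show ?thesis using \<open>i < k\<close> v(2) by (simp add: u_def rn)
      next
        case False
        then have "i - p < r" "i - p < j" "i - p + p = i" using \<open>i < k\<close> rp by simp_all
        then show ?thesis using \<open>i < k\<close> False by (simp add: u_def n_def)
      qed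
    next
      case False
      then show ?thesis using PiE_arb[OF w, of i] by (simp add: u_def)
    qed
    then have "u n = w" by blast
    moreover have "n \<in> PiE {..<j} (\<lambda>_. UNIV)" by (simp add: n_def)
    ultimately show "w \<in> u ` PiE {..<j} (\<lambda>_. UNIV)" by blast
  qed (auto simp: u_def)
  moreover have "u n i = n (i - (d - j))" if "i < k" "d - j \<le> i" for n i
  proof -
    \<comment> \<open>The existence of such an \<open>i\<close> means that the planes do share a
      coordinate, so \<open>r\<close> is positive and no truncation occurs.\<close>
    have "p = d - j" using that by (auto simp: p_def r_def)
    then show ?thesis using that by (simp add: u_def)
  qed
  ultimately show ?thesis using that by (simp add: bij_betw_def)
qed

section \<open>Transfer from coordinate planes in R^d to cubes\<close>

definition embed :: "nat \<Rightarrow> nat \<Rightarrow> nat \<Rightarrow> (nat \<Rightarrow> real) \<Rightarrow> nat \<Rightarrow> real" where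
  "embed d k off x = restrict (\<lambda>i. if off \<le> i \<and> i < off + k then x (i - off) else 0) {..<d}"

lemma cube_measure_eq: "cube_measure d k off = distr (cube {..<k}) (euclid d) (embed d k off)"
  by (simp add: cube_measure_def cube_def unit_interval_def embed_def[abs_def])

lemma measurable_embed: "embed d k off \<in> measurable (cube {..<k}) (euclid d)"
  unfolding embed_def[abs_def] euclid_def
proof (rule measurable_restrict)
  fix i
  have "(\<lambda>x. x (i - off)) \<in> borel_measurable (cube {..<k})" if "off \<le> i \<and> i < off + k"
    using that by (intro measurable_cube_component) auto
  then have "(\<lambda>x. if off \<le> i \<and> i < off + k then x (i - off) else 0) \<in> borel_measurable (cube {..<k})"
    by (cases "off \<le> i \<and> i < off + k") (simp_all only: if_P if_not_P not_False_eq_True simp_thms borel_measurable_const)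
  then show "(\<lambda>x. if off \<le> i \<and> i < off + k then x (i - off) else 0) \<in> measurable (cube {..<k}) lborel"
    by simp
qed

text \<open>On the plane an exponential sees only the projection of its frequency;
  \<open>off + k \<le> d\<close> ensures that \<open>embed\<close> cuts off no coordinate.\<close>

lemma expo_embed:
  assumes "off + k \<le> d"
  shows "expo d l (embed d k off x) = wave {..<k} (\<lambda>i. l (off + i)) x"
proof -
  have "inner_d d l (embed d k off x) = (\<Sum>i\<in>{off..<off + k}. l i * x (i - off))"
    unfolding inner_d_def embed_def using assms by (intro sum.mono_neutral_cong_right) auto
  also have "\<dots> = (\<Sum>i<k. l (off + i) * x i)"
    by (rule sum.reindex_bij_witness[of _ "\<lambda>i. off + i" "\<lambda>i. i - off"]) auto
  finally show ?thesis by (simp add: expo_def wave_def)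
qed

lemma expo_measurable: "expo d l \<in> borel_measurable (euclid d)"
proof -
  have "(\<lambda>x. x i) \<in> borel_measurable (euclid d)" if "i < d" for i
    using measurable_component_singleton[of i "{..<d}" "\<lambda>_. lborel :: real measure"] that
    by (simp add: euclid_def)
  then show ?thesis
    unfolding expo_def[abs_def] inner_d_def
    by (intro borel_measurable_cis borel_measurable_times borel_measurable_const borel_measurable_sum) auto
qed

lemma cube_measure_L2:
  assumes f: "f \<in> L2 (cube_measure d k off)"
  shows "(\<lambda>x. f (embed d k off x)) \<in> L2 (cube {..<k})"
proof -
  have m: "f \<in> borel_measurable (euclid d)"
    using L2_measurable[OF f] by (simp add: cube_measure_eq)
  have "integrable (cube {..<k}) (\<lambda>x. (cmod (f (embed d k off x)))\<^sup>2)"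
    using L2_integrable_sq[OF f] integrable_distr[OF measurable_embed] by (simp add: cube_measure_eq)
  then show ?thesis using measurable_compose[OF measurable_embed m] by (simp add: L2_def)
qed

lemma L2_norm_sq_cube_measure:
  assumes f: "f \<in> borel_measurable (euclid d)"
  shows "L2_norm_sq (cube_measure d k off) f = L2_norm_sq (cube {..<k}) (\<lambda>x. f (embed d k off x))"
  unfolding L2_norm_sq_def cube_measure_eq using f by (intro integral_distr measurable_embed) measurable

lemma L2_inner_cube_measure:
  assumes f: "f \<in> borel_measurable (euclid d)" and "off + k \<le> d"
  shows "L2_inner (cube_measure d k off) f (expo d l)
    = L2_inner (cube {..<k}) (\<lambda>x. f (embed d k off x)) (wave {..<k} (\<lambda>i. l (off + i)))"
  unfolding L2_inner_def cube_measure_eq expo_embed[OF assms(2), symmetric]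
  by (intro integral_distr measurable_embed borel_measurable_times borel_measurable_cnj f expo_measurable)

lemma wave_cong: "(\<And>i. i \<in> I \<Longrightarrow> n i = m i) \<Longrightarrow> wave I n = wave I m"
  by (simp add: wave_def[abs_def] cong: sum.cong)

lemma L2_add_measureD:
  assumes s: "sets N = sets M" and f: "f \<in> L2 (add_measure M N)"
  shows "f \<in> L2 M" "f \<in> L2 N"
  using integrable_add_measure[OF s L2_integrable_sq[OF f]]
    borel_measurable_sets_eq[OF _ L2_measurable[OF f], of M]
    borel_measurable_sets_eq[OF _ L2_measurable[OF f], of N] s
  unfolding L2_def by simp_all

lemma L2_add_measureI:
  assumes s: "sets N = sets M" and f: "f \<in> L2 M" "f \<in> L2 N"
  shows "f \<in> L2 (add_measure M N)"
proof (rule L2_of_nn_integral_finite)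
  note [measurable] = L2_measurable[OF f(1)]
  have "(\<integral>\<^sup>+x. ennreal ((cmod (f x))\<^sup>2) \<partial>add_measure M N)
      = ennreal (L2_norm_sq M f) + ennreal (L2_norm_sq N f)"
    unfolding ennreal_L2_norm_sq[OF f(1), symmetric] ennreal_L2_norm_sq[OF f(2), symmetric]
    by (rule nn_integral_add_measure[OF s]) measurable
  then show "(\<integral>\<^sup>+x. ennreal ((cmod (f x))\<^sup>2) \<partial>add_measure M N) < \<infinity>" by simp
qed (rule borel_measurable_sets_eq[OF sets_add_measure L2_measurable[OF f(1)]])

lemma expo_L2: "expo d l \<in> L2 (cube_measure d k off)"
proof -
  interpret prob_space "cube_measure d k off"
    unfolding cube_measure_eq by (rule cube.prob_space_distr[OF measurable_embed])
  have "expo d l \<in> borel_measurable (cube_measure d k off)"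
    by (rule borel_measurable_sets_eq[OF _ expo_measurable]) (simp add: cube_measure_eq)
  then show ?thesis by (rule L2_bounded[where B=1]) (simp add: expo_def)
qed

theorem theorem2p2:
  fixes d j k :: nat
  assumes "d \<ge> 2" and "1 \<le> j" and "j \<le> d - 1" and "1 \<le> k" and "k \<le> d - 1"
  shows "admits_fourier_frame d (add_measure (cube_measure d k 0) (cube_measure d j (d - j)))"
proof -
  let ?M = "cube_measure d k 0" and ?N = "cube_measure d j (d - j)"
  let ?Z = "PiE {..<j} (\<lambda>_. UNIV :: int set)"
  have jk: "j < d" "k < d" "j \<ge> 1" "k \<ge> 1" "0 + k \<le> d" "d - j + j \<le> d" using assms by auto
  obtain u where u: "bij_betw u ?Z (PiE {..<k} (\<lambda>_. UNIV))"
    and shared: "\<And>n i. i < k \<Longrightarrow> d - j \<le> i \<Longrightarrow> u n i = n (i - (d - j))"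
    using ex_compatible_bij[of j d k] jk by metis
  \<comment> \<open>Coordinates lying in neither plane, \<open>k \<le> i < d - j\<close>, get the
    default value 0.\<close>
  define \<alpha> where "\<alpha> n = (\<lambda>i\<in>{..<d}. if i < d - j then if i < k then real_of_int (u n i) else 0
      else real_of_int (n (i - (d - j))))" for n
  \<comment> \<open>Coordinate \<open>d - 1\<close> is the last one of the second plane and, as
    \<open>k < d\<close>, lies outside the first; the projection \<open>u n\<close> is thus
    unchanged.\<close>
  define \<beta> where "\<beta> n = (\<alpha> n)(d - 1 := 1 / 2 - real_of_int (n (j - 1)))" for n
  have \<alpha>_last: "\<alpha> n (d - 1) = real_of_int (n (j - 1))" for n
    using jk by (auto simp: \<alpha>_def intro: arg_cong[where f=n])
  have \<alpha>_tail: "\<alpha> n (d - j + i) = real_of_int (n i)" if "i < j" for n i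
  proof -
    have "\<not> d - j + i < d - j" "d - j + i < d" "d - j + i - (d - j) = i" using jk that by simp_all
    then show ?thesis by (simp only: \<alpha>_def restrict_apply lessThan_iff if_True if_False)
  qed
  have \<beta>_tail: "\<beta> n (d - j + i) = ((\<lambda>i. real_of_int (n i))(j - 1 := 1 / 2 - real_of_int (n (j - 1)))) i"
    if "i < j" for n i
    using jk that \<alpha>_tail[OF that] by (auto simp: \<beta>_def)
  have \<alpha>_head: "\<alpha> n i = real_of_int (u n i)" if "i < k" for n i
    using jk that shared[OF that] by (auto simp: \<alpha>_def)
  have \<beta>_head: "\<beta> n i = real_of_int (u n i)" if "i < k" for n i
    using jk that \<alpha>_head[OF that] by (auto simp: \<beta>_def)
  have inj_\<alpha>: "inj_on \<alpha> ?Z"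
  proof (rule inj_onI)
    fix n n' assume n: "n \<in> ?Z" "n' \<in> ?Z" and eq: "\<alpha> n = \<alpha> n'"
    show "n = n'"
      using n by (rule PiE_ext) (use \<alpha>_tail[of _ n] \<alpha>_tail[of _ n'] eq in auto)
  qed
  have inj_\<beta>: "inj_on \<beta> ?Z"
  proof (rule inj_onI)
    fix n n' assume n: "n \<in> ?Z" "n' \<in> ?Z" and eq: "\<beta> n = \<beta> n'"
    have "n i = n' i" if "i < j" for i
      using \<beta>_tail[OF that, of n] \<beta>_tail[OF that, of n'] eq by (cases "i = j - 1") auto
    with n show "n = n'" by (intro PiE_ext[OF n]) auto
  qed
  \<comment> \<open>The last coordinate is an integer on one side and lies in 1/2 + Z on the other.
    Disjointness allows the two sums to be added over the union.\<close>
  have "\<alpha> n \<noteq> \<beta> n'" for n n'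
  proof
    assume "\<alpha> n = \<beta> n'"
    then have "real_of_int (n (j - 1)) = 1 / 2 - real_of_int (n' (j - 1))"
      using \<alpha>_last[of n] by (simp add: \<beta>_def)
    then have "real_of_int (2 * (n (j - 1) + n' (j - 1))) = real_of_int 1" by simp
    then have "2 * (n (j - 1) + n' (j - 1)) = 1" by (rule of_int_eq_iff[THEN iffD1])
    then show False by presburger
  qed
  then have disj: "\<alpha> ` ?Z \<inter> \<beta> ` ?Z = {}" by auto
  let ?\<Lambda> = "\<alpha> ` ?Z \<union> \<beta> ` ?Z"
  have "countable ?Z" by (rule countable_PiE) auto
  then have "countable ?\<Lambda>" by simp
  moreover have "?\<Lambda> \<subseteq> space (euclid d)"
  proof -
    have \<alpha>: "\<alpha> n \<in> extensional {..<d}" for n unfolding \<alpha>_def by (rule restrict_extensional)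
    have "\<beta> n \<in> extensional {..<d}" for n
      using \<alpha>[of n] jk by (simp add: \<beta>_def extensional_def)
    with \<alpha> have "\<alpha> n \<in> space (euclid d) \<and> \<beta> n \<in> space (euclid d)" for n
      by (simp add: euclid_def space_PiM PiE_iff)
    then show ?thesis by blast
  qed
  moreover have "fourier_frame d (add_measure ?M ?N) ?\<Lambda>"
    unfolding fourier_frame_def
  \<comment> \<open>These are the constants of \<open>paired_frame_bounds\<close>.\<close>
  proof (rule exI[of _ "1 / 5"], rule exI[of _ 4], intro conjI ballI)
    fix f assume f: "f \<in> L2 (add_measure ?M ?N)"
    let ?I = "\<lambda>l. L2_inner (add_measure ?M ?N) f (expo d l)"
    have s: "sets ?N = sets ?M" by (simp add: cube_measure_eq)
    have m: "f \<in> borel_measurable (euclid d)"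
      by (rule borel_measurable_sets_eq[OF _ L2_measurable[OF f]]) (simp add: cube_measure_eq)
    define F where "F = (\<lambda>x. f (embed d k 0 x))"
    define G where "G = (\<lambda>x. f (embed d j (d - j) x))"
    note L2_parts = L2_add_measureD[OF s f]
    have F: "F \<in> L2 (cube {..<k})" unfolding F_def by (rule cube_measure_L2[OF L2_parts(1)])
    have G: "G \<in> L2 (cube {..<j})" unfolding G_def by (rule cube_measure_L2[OF L2_parts(2)])
    have norm: "L2_norm_sq (add_measure ?M ?N) f
        = L2_norm_sq (cube {..<k}) F + L2_norm_sq (cube {..<j}) G"
      using integral_add_measure[OF s L2_integrable_sq[OF f]]
      by (simp add: F_def G_def L2_norm_sq_cube_measure[OF m, symmetric]) (simp add: L2_norm_sq_def)
    define a where "a n = L2_inner (cube {..<k}) F (wave {..<k} (\<lambda>i. real_of_int (u n i)))" for n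
    define b where "b n = L2_inner (cube {..<j}) G (wave {..<j} (\<lambda>i. real_of_int (n i)))" for n
    define b' where "b' n = L2_inner (cube {..<j}) (twist (j - 1) G)
        (wave {..<j} (\<lambda>i. real_of_int (n i)))" for n
    have L: "finite {..<j}" "j - 1 \<in> {..<j}" using jk by auto
    have inner: "?I l = L2_inner (cube {..<k}) F (wave {..<k} l)
        + L2_inner (cube {..<j}) G (wave {..<j} (\<lambda>i. l (d - j + i)))" for l
    proof -
      have "expo d l \<in> L2 (add_measure ?M ?N)"
        by (intro L2_add_measureI s expo_L2)
      then have "?I l = L2_inner ?M f (expo d l) + L2_inner ?N f (expo d l)"
        unfolding L2_inner_def by (intro integral_add_measure s L2_mult_cnj_integrable f)
      then show ?thesis
        using L2_inner_cube_measure[OF m jk(5), of l] L2_inner_cube_measure[OF m jk(6), of l]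
        by (simp add: F_def G_def)
    qed
    have I\<alpha>: "?I (\<alpha> n) = a n + b n" for n
      unfolding inner a_def b_def
      using wave_cong[of "{..<k}" "\<alpha> n" "\<lambda>i. real_of_int (u n i)"]
        wave_cong[of "{..<j}" "\<lambda>i. \<alpha> n (d - j + i)" "\<lambda>i. real_of_int (n i)"]
      by (simp add: \<alpha>_head \<alpha>_tail)
    have I\<beta>: "?I (\<beta> n) = a n + b' n" for n
      unfolding inner a_def b'_def L2_inner_twist[OF L G]
      using wave_cong[of "{..<k}" "\<beta> n" "\<lambda>i. real_of_int (u n i)"]
        wave_cong[of "{..<j}" "\<lambda>i. \<beta> n (d - j + i)"
          "(\<lambda>i. real_of_int (n i))(j - 1 := 1 / 2 - real_of_int (n (j - 1)))"]
      by (simp add: \<beta>_head \<beta>_tail)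
    let ?A = "L2_norm_sq (cube {..<k}) F" and ?B = "L2_norm_sq (cube {..<j}) G"
    \<comment> \<open>As \<open>u\<close> is a bijection onto the integer lattice of the first
      plane, each coefficient of \<open>F\<close> occurs exactly once.\<close>
    have a: "((\<lambda>n. (cmod (a n))\<^sup>2) has_sum ?A) ?Z"
      unfolding a_def
      using has_sum_reindex_bij_betw[OF u, of
          "\<lambda>w. (cmod (L2_inner (cube {..<k}) F (wave {..<k} (\<lambda>i. real_of_int (w i)))))\<^sup>2"]
        parseval_cube_has_sum[OF finite_lessThan F] by simp
    have b: "((\<lambda>n. (cmod (b n))\<^sup>2) has_sum ?B) ?Z"
      unfolding b_def by (rule parseval_cube_has_sum[OF L(1) G])
    have b': "((\<lambda>n. (cmod (b' n))\<^sup>2) has_sum ?B) ?Z"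
      unfolding b'_def L2_norm_sq_twist[OF L G, symmetric]
      by (rule parseval_cube_has_sum[OF L(1) twist_L2[OF L G]])
    have "b n - b' n = L2_inner (cube {..<j}) (\<lambda>x. G x - twist (j - 1) G x)
        (wave {..<j} (\<lambda>i. real_of_int (n i)))" for n
      unfolding b_def b'_def L2_inner_def
      using cube_L2_imp_integrable_wave[OF G] cube_L2_imp_integrable_wave[OF twist_L2[OF L G]]
      by (simp add: left_diff_distrib)
    then have d: "((\<lambda>n. (cmod (b n - b' n))\<^sup>2) has_sum 2 * ?B) ?Z"
      using parseval_cube_has_sum[OF L(1) L2_diff[OF G twist_L2[OF L G]]]
      by (simp only: L2_norm_sq_diff_twist[OF L G])
    obtain S S' where S: "((\<lambda>n. (cmod (a n + b n))\<^sup>2) has_sum S) ?Z"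
        "((\<lambda>n. (cmod (a n + b' n))\<^sup>2) has_sum S') ?Z"
      and bounds: "?A + ?B \<le> 5 * (S + S')" "S + S' \<le> 4 * (?A + ?B)"
      using paired_frame_bounds[OF a b b' d] by blast
    \<comment> \<open>Injectivity of \<alpha> and \<beta> turns sums over lattice points into sums
      over sets of frequencies.\<close>
    have "((\<lambda>l. (cmod (?I l))\<^sup>2) has_sum S) (\<alpha> ` ?Z)" "((\<lambda>l. (cmod (?I l))\<^sup>2) has_sum S') (\<beta> ` ?Z)"
      using S by (simp_all add: has_sum_reindex[OF inj_\<alpha>] has_sum_reindex[OF inj_\<beta>] o_def I\<alpha> I\<beta>)
    then have total: "((\<lambda>l. (cmod (?I l))\<^sup>2) has_sum (S + S')) ?\<Lambda>"
      using disj by (rule has_sum_Un_disjoint)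
    then show "(\<lambda>l. (cmod (?I l))\<^sup>2) summable_on ?\<Lambda>" by (auto simp: summable_on_def)
    show "1 / 5 * L2_norm_sq (add_measure ?M ?N) f \<le> (\<Sum>\<^sub>\<infinity>l\<in>?\<Lambda>. (cmod (?I l))\<^sup>2)"
      "(\<Sum>\<^sub>\<infinity>l\<in>?\<Lambda>. (cmod (?I l))\<^sup>2) \<le> 4 * L2_norm_sq (add_measure ?M ?N) f"
      using bounds infsumI[OF total] norm by simp_all
  qed simp_all
  ultimately show ?thesis unfolding admits_fourier_frame_def by blast
qed

end
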